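(* Let $(\mathcal{C},\lambda)$ be a $(2n+1)$-dimensional contact manifold with canonical coordinates $(x,p,z)$, $\lambda=dz-p_a\,dx^a$, let $\psi$ be a function of $x$ only, let $F^1,\dots,F^n$ be functions of $x$ that do not identically vanish, and let $\gamma_0$ be a non-zero constant. Let $X_h$ be the contact Hamiltonian vector field associated to $$h(x,p,z)=\Big(\frac{\partial\psi}{\partial x^a}(x)-p_a\Big)F^a(x)+\gamma_0\,(\psi(x)-z),$$ considered for initial conditions with $h(x(0),p(0),z(0))>0$, i.e. on the region $\{h>0\}$. Then, within the class of densities depending on $(x,p,z)$ only through $h$, an invariant measure for $X_h$ is $$\Omega^{\mathrm{Inv}}=f^{\mathrm{Inv}}\,\Omega_\lambda,\qquad f^{\mathrm{Inv}}=\frac{1}{Z}\,h^{-(n+1)},$$ where $Z$ is a non-zero constant.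
   Context: All objects are smooth and repeated indices are summed over $1,\dots,n$. The standard volume form is $\Omega_\lambda=\lambda\wedge\underbrace{d\lambda\wedge\dots\wedge d\lambda}_{n}$. An invariant measure for a vector field $X$ is a non-vanishing top-degree form $\Omega$ with $\partial\Omega/\partial t=0$ (no explicit time dependence) and $\mathcal{L}_X\Omega=0$, where $\mathcal{L}_X$ is the Lie derivative. The contact Hamiltonian vector field $X_h$ of a function $h$ is defined by $\iota_{X_h}\lambda=h$, $\iota_{X_h}d\lambda=-(dh-(\mathcal{R}h)\lambda)$ with $\mathcal{R}=\partial/\partial z$; in coordinates $\dot x^a=-\partial h/\partial p_a$, $\dot p_a=\partial h/\partial x^a+p_a\,\partial h/\partial z$, $\dot z=h-p_a\,\partial h/\partial p_a$. *)

theory Defs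
  imports "HOL-Analysis.Analysis"
begin

section \<open>Smooth functions on open sets\<close>

text \<open>
  On an open set, \<open>f\<close> is of class \<open>C\<^sup>k\<^sup>+\<^sup>1\<close> iff it is differentiable and all its directional
  derivatives are of class \<open>C\<^sup>k\<close>.  The predicates are only meant for open \<open>S\<close>.
\<close>

fun Ck_on :: "nat \<Rightarrow> 'a::euclidean_space set \<Rightarrow> ('a \<Rightarrow> 'b::real_normed_vector) \<Rightarrow> bool" where
  "Ck_on 0 S f \<longleftrightarrow> continuous_on S f"
| "Ck_on (Suc k) S f \<longleftrightarrow>
     (\<forall>x\<in>S. f differentiable (at x)) \<and> (\<forall>v. Ck_on k S (\<lambda>x. frechet_derivative f (at x) v))"

definition smooth_on :: "'a::euclidean_space set \<Rightarrow> ('a \<Rightarrow> 'b::real_normed_vector) \<Rightarrow> bool" where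
  "smooth_on S f \<longleftrightarrow> (\<forall>k. Ck_on k S f)"

section \<open>Differential forms on open subsets of a Euclidean space\<close>

text \<open>
  A \<open>k\<close>-form is a map \<open>\<omega>\<close> taking a point \<open>q\<close> and tangent vectors \<open>v 0, \<dots>, v (k - 1)\<close> to a real
  number.  The vectors are given as a sequence \<open>v :: nat \<Rightarrow> 'a\<close>, of which a \<open>k\<close>-form only looks at
  the first \<open>k\<close> entries; the degree is therefore an explicit argument of the operations below.
\<close>

type_synonym 'a form = "'a \<Rightarrow> (nat \<Rightarrow> 'a) \<Rightarrow> real"

definition diff_form :: "nat \<Rightarrow> 'a::euclidean_space set \<Rightarrow> 'a form \<Rightarrow> bool" where
  "diff_form k M \<omega> \<longleftrightarrow>
     (\<forall>q\<in>M. \<forall>v w. (\<forall>i<k. v i = w i) \<longrightarrow> \<omega> q v = \<omega> q w) \<and>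
     (\<forall>q\<in>M. \<forall>v. \<forall>i<k. linear (\<lambda>u. \<omega> q (v(i := u)))) \<and>
     (\<forall>q\<in>M. \<forall>v. \<forall>i<k. \<forall>j<k. i \<noteq> j \<and> v i = v j \<longrightarrow> \<omega> q v = 0) \<and>
     (\<forall>v. smooth_on M (\<lambda>q. \<omega> q v))"

text \<open>
  Normalisation: \<open>(\<alpha> \<and> \<beta>)(v, w) = \<alpha>(v) \<beta>(w) - \<alpha>(w) \<beta>(v)\<close> for 1-forms.
\<close>

definition wedge :: "nat \<Rightarrow> nat \<Rightarrow> 'a form \<Rightarrow> 'a form \<Rightarrow> 'a form" where
  "wedge k l \<alpha> \<beta> = (\<lambda>q v.
     (\<Sum>\<sigma> | \<sigma> permutes {..<k + l}.
        of_int (sign \<sigma>) * \<alpha> q (\<lambda>i. v (\<sigma> i)) * \<beta> q (\<lambda>i. v (\<sigma> (k + i))))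
     / (fact k * fact l))"

fun wedge_power :: "nat \<Rightarrow> 'a form \<Rightarrow> nat \<Rightarrow> 'a form" where
  "wedge_power k \<omega> 0 = (\<lambda>q v. 1)"
| "wedge_power k \<omega> (Suc m) = wedge k (m * k) \<omega> (wedge_power k \<omega> m)"

text \<open>
  \<open>(d\<omega>)(v\<^sub>0, \<dots>, v\<^sub>k) = \<Sum>\<^sub>i (-1)\<^sup>i v\<^sub>i(\<omega>(v\<^sub>0, \<dots>, v\<^sub>i\<^sub>-\<^sub>1, v\<^sub>i\<^sub>+\<^sub>1, \<dots>, v\<^sub>k))\<close> for constant vector fields \<open>v\<^sub>i\<close>
  (whose Lie brackets vanish).
\<close>

definition ext_deriv :: "nat \<Rightarrow> 'a::euclidean_space form \<Rightarrow> 'a form" where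
  "ext_deriv k \<omega> = (\<lambda>q v.
     \<Sum>i\<le>k. (-1) ^ i *
       frechet_derivative (\<lambda>r. \<omega> r (\<lambda>j. if j < i then v j else v (Suc j))) (at q) (v i))"

definition interior_prod :: "('a \<Rightarrow> 'a) \<Rightarrow> 'a form \<Rightarrow> 'a form" where
  "interior_prod X \<omega> = (\<lambda>q v. \<omega> q (case_nat (X q) v))"

definition lie_bracket :: "('a \<Rightarrow> 'a) \<Rightarrow> ('a \<Rightarrow> 'a) \<Rightarrow> 'a::euclidean_space \<Rightarrow> 'a" where
  "lie_bracket X Y = (\<lambda>q. frechet_derivative Y (at q) (X q) - frechet_derivative X (at q) (Y q))"

text \<open>
  \<open>(\<L>\<^sub>X \<omega>)(Y\<^sub>1, \<dots>, Y\<^sub>k) = X(\<omega>(Y\<^sub>1, \<dots>, Y\<^sub>k)) - \<Sum>\<^sub>i \<omega>(Y\<^sub>1, \<dots>, [X, Y\<^sub>i], \<dots>, Y\<^sub>k)\<close>.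
  The right-hand side is tensorial in the \<open>Y\<^sub>i\<close>, so at a point it suffices to extend the given
  tangent vectors by constant vector fields.
\<close>

definition lie_deriv :: "nat \<Rightarrow> ('a \<Rightarrow> 'a) \<Rightarrow> 'a::euclidean_space form \<Rightarrow> 'a form" where
  "lie_deriv k X \<omega> = (\<lambda>q v.
     frechet_derivative (\<lambda>r. \<omega> r v) (at q) (X q)
     - (\<Sum>i<k. \<omega> q (v(i := lie_bracket X (\<lambda>_. v i) q))))"

text \<open>
  \<open>\<Omega> t\<close> is the form at time \<open>t\<close>.  A top-degree form is non-vanishing iff it is nonzero, as an
  alternating map, at every point.
\<close>

definition invariant_measure ::
  "'a::euclidean_space set \<Rightarrow> ('a \<Rightarrow> 'a) \<Rightarrow> (real \<Rightarrow> 'a form) \<Rightarrow> bool" where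
  "invariant_measure M X \<Omega> \<longleftrightarrow>
     (\<forall>t. diff_form DIM('a) M (\<Omega> t)) \<and>
     (\<forall>t. \<forall>q\<in>M. \<exists>v. \<Omega> t q v \<noteq> 0) \<and>
     (\<forall>t. \<forall>q\<in>M. \<forall>v. ((\<lambda>s. \<Omega> s q v) has_real_derivative 0) (at t)) \<and>
     (\<forall>t. \<forall>q\<in>M. \<forall>v. lie_deriv DIM('a) X (\<Omega> t) q v = 0)"

section \<open>Contact geometry in canonical coordinates\<close>

type_synonym 'n phase = "(real ^ 'n) \<times> (real ^ 'n) \<times> real"  \<comment> \<open>\<open>(x, p, z)\<close>\<close>

text \<open>\<open>\<lambda> = dz - p\<^sub>a dx\<^sup>a\<close>\<close>

definition contact_form :: "('n::finite) phase form" where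
  "contact_form = (\<lambda>(x, p, z) v.
     (case v 0 of (dx, dp, dz) \<Rightarrow> dz - (\<Sum>a\<in>UNIV. p $ a * dx $ a)))"

definition contact_volume :: "('n::finite) phase form" where
  "contact_volume =
     wedge 1 (CARD('n) * 2) contact_form (wedge_power 2 (ext_deriv 1 contact_form) CARD('n))"

definition reeb :: "('n::finite phase \<Rightarrow> real) \<Rightarrow> 'n phase \<Rightarrow> real" where
  "reeb h q = frechet_derivative h (at q) (0, 0, 1)"

text \<open>\<open>\<iota>\<^sub>X \<lambda> = h\<close> and \<open>\<iota>\<^sub>X d\<lambda> = -(dh - (\<R>h) \<lambda>)\<close> on \<open>U\<close>\<close>

definition contact_hamiltonian_vf ::
  "'n::finite phase set \<Rightarrow> ('n phase \<Rightarrow> real) \<Rightarrow> ('n phase \<Rightarrow> 'n phase) \<Rightarrow> bool" where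
  "contact_hamiltonian_vf U h X \<longleftrightarrow>
     (\<forall>q\<in>U. \<forall>v. interior_prod X contact_form q v = h q) \<and>
     (\<forall>q\<in>U. \<forall>v. interior_prod X (ext_deriv 1 contact_form) q v =
        - (ext_deriv 0 (\<lambda>r _. h r) q v - reeb h q * contact_form q v))"

definition partial_deriv :: "(real ^ 'n \<Rightarrow> real) \<Rightarrow> 'n::finite \<Rightarrow> real ^ 'n \<Rightarrow> real" where
  "partial_deriv \<psi> a x = frechet_derivative \<psi> (at x) (axis a 1)"

lemma ext_deriv_contact_form:
  fixes q :: "'n::finite phase"
  shows "ext_deriv 1 contact_form q v =
    (\<Sum>a\<in>UNIV. fst (v 0) $ a * fst (snd (v 1)) $ a - fst (snd (v 0)) $ a * fst (v 1) $ a)"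
proof -
  have "((\<lambda>r::'n phase. contact_form r w) has_derivative
      (\<lambda>u. - (\<Sum>a\<in>UNIV. fst (snd u) $ a * fst (w 0) $ a))) (at q)" for w
  proof -
    have l: "((\<lambda>r::'n phase. fst (snd r) $ a) has_derivative (\<lambda>u. fst (snd u) $ a)) (at q)" for a
      by (rule bounded_linear_imp_has_derivative)
        (simp add: linear_conv_bounded_linear[symmetric] linear_iff)
    show ?thesis
      unfolding contact_form_def case_prod_beta
      by (auto intro!: derivative_eq_intros l)
  qed
  then have *: "frechet_derivative (\<lambda>r::'n phase. contact_form r w) (at q)
      = (\<lambda>u. - (\<Sum>a\<in>UNIV. fst (snd u) $ a * fst (w 0) $ a))" for w
    by (rule frechet_derivative_at[symmetric])
  have "{..1::nat} = {0, 1}" by auto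
  then show ?thesis
    by (simp add: ext_deriv_def * sum_subtractf mult.commute)
qed

text \<open>
  The intrinsic conditions determine the vector field uniquely, with the usual coordinate expression.
\<close>

lemma contact_hamiltonian_vf_coordinates:
  fixes h :: "'n::finite phase \<Rightarrow> real"
  assumes "\<And>q. q \<in> U \<Longrightarrow> h differentiable (at q)"
  shows "contact_hamiltonian_vf U h X \<longleftrightarrow>
    (\<forall>(x, p, z)\<in>U. X (x, p, z) =
       (let D = frechet_derivative h (at (x, p, z)) in
         (\<chi> a. - D (0, axis a 1, 0),
          \<chi> a. D (axis a 1, 0, 0) + p $ a * D (0, 0, 1),
          h (x, p, z) - (\<Sum>a\<in>UNIV. p $ a * D (0, axis a 1, 0)))))"
proof -
  have "((\<forall>v. interior_prod X contact_form q v = h q) \<and>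
     (\<forall>v. interior_prod X (ext_deriv 1 contact_form) q v =
        - (ext_deriv 0 (\<lambda>r _. h r) q v - reeb h q * contact_form q v))) \<longleftrightarrow>
     X q = (\<chi> a. - frechet_derivative h (at q) (0, axis a 1, 0),
          \<chi> a. frechet_derivative h (at q) (axis a 1, 0, 0)
             + p $ a * frechet_derivative h (at q) (0, 0, 1),
          h q - (\<Sum>a\<in>UNIV. p $ a * frechet_derivative h (at q) (0, axis a 1, 0)))"
    (is "?L \<longleftrightarrow> X q = ?R") if q: "q \<in> U" "q = (x, p, z)" for q x p z
  proof -
    define D where "D = frechet_derivative h (at q)"
    obtain X1 X2 X3 where X: "X q = (X1, X2, X3)" by (cases "X q") auto
    have lin: "linear D"
      unfolding D_def using assms[OF q(1)] by (rule linear_frechet_derivative)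
    have D: "D (u, w, s) = (\<Sum>a\<in>UNIV. u $ a * D (axis a 1, 0, 0))
        + (\<Sum>a\<in>UNIV. w $ a * D (0, axis a 1, 0)) + s * D (0, 0, 1)" for u w s
    proof -
      have e: "(u, w, s) = (u, 0, 0) + (0, w, 0) + s *\<^sub>R (0, 0, 1)" by simp
      have l1: "linear (\<lambda>u. D (u, 0, 0))" "linear (\<lambda>w. D (0, w, 0))"
        using linear_compose[OF _ lin, of "\<lambda>u. (u, 0, 0)"]
          linear_compose[OF _ lin, of "\<lambda>w. (0, w, 0)"]
        by (auto simp: o_def linear_iff)
      have ex: "(\<Sum>a\<in>UNIV. y $ a *\<^sub>R axis a 1) = (y :: real ^ 'n)" for y
        using basis_expansion[of y] by (simp add: scalar_mult_eq_scaleR)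
      have s: "L y = (\<Sum>a\<in>UNIV. y $ a * L (axis a 1))"
        if "linear L" for L :: "real ^ 'n \<Rightarrow> real" and y
        using arg_cong[OF ex[of y], of L] that by (simp add: linear_sum linear_cmul)
      show ?thesis
        unfolding e linear_add[OF lin] linear_cmul[OF lin]
        using s[OF l1(1), of u] s[OF l1(2), of w] by simp
    qed
    have L1: "(\<forall>v. interior_prod X contact_form q v = h q) \<longleftrightarrow>
        X3 - (\<Sum>a\<in>UNIV. p $ a * X1 $ a) = h q"
      by (simp add: interior_prod_def contact_form_def X q(2)[symmetric])
        (simp add: q(2))
    have val: "interior_prod X (ext_deriv 1 contact_form) q v =
        (\<Sum>a\<in>UNIV. X1 $ a * fst (snd (v 0)) $ a - X2 $ a * fst (v 0) $ a)" for v
      by (simp add: interior_prod_def ext_deriv_contact_form X del: One_nat_def) simp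
    have cf: "contact_form q v = snd (snd (v 0)) - (\<Sum>a\<in>UNIV. p $ a * fst (v 0) $ a)" for v
      by (simp add: contact_form_def q(2) case_prod_beta)
    have dh: "ext_deriv 0 (\<lambda>r _. h r) q v = D (v 0)" for v
      by (simp add: ext_deriv_def D_def)
    have L2: "(\<forall>v. interior_prod X (ext_deriv 1 contact_form) q v =
        - (ext_deriv 0 (\<lambda>r _. h r) q v - reeb h q * contact_form q v)) \<longleftrightarrow>
        (\<forall>a. X1 $ a = - D (0, axis a 1, 0)) \<and>
        (\<forall>a. X2 $ a = D (axis a 1, 0, 0) + p $ a * D (0, 0, 1))" (is "?A \<longleftrightarrow> ?B")
    proof
      assume ?A
      have A: "(\<Sum>a\<in>UNIV. X1 $ a * fst (snd (v 0)) $ a - X2 $ a * fst (v 0) $ a) =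
          - (D (v 0) - D (0, 0, 1) * (snd (snd (v 0)) - (\<Sum>a\<in>UNIV. p $ a * fst (v 0) $ a)))"
        for v :: "nat \<Rightarrow> 'n phase"
        using \<open>?A\<close> unfolding val cf dh reeb_def D_def[symmetric] by blast
      have ax: "(\<Sum>b\<in>UNIV. f b * axis a (1::real) $ b) = f a" for f :: "'n \<Rightarrow> real" and a
        by (simp add: axis_def if_distrib cong: if_cong)
      show ?B
      proof (intro conjI allI)
        fix a
        show "X1 $ a = - D (0, axis a 1, 0)"
          using A[of "\<lambda>_. (0, axis a 1, 0)"] by (simp add: ax)
        show "X2 $ a = D (axis a 1, 0, 0) + p $ a * D (0, 0, 1)"
          using A[of "\<lambda>_. (axis a 1, 0, 0)"] by (simp add: ax sum_negf mult.commute)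
      qed
    next
      assume B: ?B
      show ?A
      proof
        fix v :: "nat \<Rightarrow> 'n phase"
        obtain u w s where v: "v 0 = (u, w, s)" by (cases "v 0") auto
        have "(\<Sum>a\<in>UNIV. X1 $ a * w $ a - X2 $ a * u $ a) =
            - (\<Sum>a\<in>UNIV. w $ a * D (0, axis a 1, 0)) - (\<Sum>a\<in>UNIV. u $ a * D (axis a 1, 0, 0))
            - D (0, 0, 1) * (\<Sum>a\<in>UNIV. p $ a * u $ a)"
          unfolding sum_distrib_left sum_negf[symmetric] sum_subtractf[symmetric]
          by (rule sum.cong) (simp_all add: B algebra_simps)
        then show "interior_prod X (ext_deriv 1 contact_form) q v =
          - (ext_deriv 0 (\<lambda>r _. h r) q v - reeb h q * contact_form q v)"
          unfolding val cf dh v reeb_def D_def[symmetric]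
          using D[of u w s] by (simp add: right_diff_distrib mult.commute)
      qed
    qed
    show ?thesis
      unfolding L1 L2 X D_def[symmetric] prod.inject vec_eq_iff vec_lambda_beta
      by (auto simp: sum_negf)
  qed
  note pw = this
  show ?thesis
    unfolding contact_hamiltonian_vf_def ball_conj_distrib[symmetric]
  proof (rule ball_cong[OF refl])
    fix q assume q: "q \<in> U"
    obtain x p z where xpz: "q = (x, p, z)" by (cases q) auto
    show "((\<forall>v. interior_prod X contact_form q v = h q) \<and>
       (\<forall>v. interior_prod X (ext_deriv 1 contact_form) q v =
          - (ext_deriv 0 (\<lambda>r _. h r) q v - reeb h q * contact_form q v))) \<longleftrightarrow>
       (case q of (x, p, z) \<Rightarrow> X (x, p, z) =
         (let D = frechet_derivative h (at (x, p, z)) in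
           (\<chi> a. - D (0, axis a 1, 0),
            \<chi> a. D (axis a 1, 0, 0) + p $ a * D (0, 0, 1),
            h (x, p, z) - (\<Sum>a\<in>UNIV. p $ a * D (0, axis a 1, 0)))))"
      unfolding pw[OF q xpz] unfolding xpz prod.case Let_def by (rule refl)
  qed
qed

end

theory Submission
  imports Defs
begin

text \<open>
  In canonical coordinates \<open>\<Omega>\<^sub>\<lambda>\<close> has constant coefficients, so \<open>\<L>\<^sub>X (f \<Omega>\<^sub>\<lambda>) = (X f + f div X) \<Omega>\<^sub>\<lambda>\<close>
  with the Euclidean divergence.  For \<open>h = H(x) - p\<^sub>a F\<^sup>a(x) - \<gamma>\<^sub>0 z\<close> the terms in \<open>div F\<close> cancel and
  \<open>div X\<^sub>h = -(n + 1) \<gamma>\<^sub>0\<close>, while \<open>X\<^sub>h h = h \<partial>h/\<partial>z = - \<gamma>\<^sub>0 h\<close>.  Hence \<open>f = g(h)\<close> is invariant iff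
  \<open>s g'(s) = -(n + 1) g(s)\<close> on \<open>h(M)\<close>, that is, iff \<open>g(s) s\<^sup>n\<^sup>+\<^sup>1\<close> has derivative zero there.  If \<open>U\<close> is
  connected then \<open>h(M) = h(U) \<inter> (0, \<infinity>)\<close> is an interval even if \<open>M\<close> is disconnected, so this product
  is constant.
\<close>

section \<open>Alternating forms and wedge products\<close>

text \<open>The algebraic part of \<open>diff_form\<close>, isolated for the map at a single point
  so that multilinear algebra can be done without base points or smoothness.\<close>

definition alternating_form :: "nat \<Rightarrow> ((nat \<Rightarrow> 'a::real_vector) \<Rightarrow> real) \<Rightarrow> bool" where
  "alternating_form k \<eta> \<longleftrightarrow>
     (\<forall>v w. (\<forall>i<k. v i = w i) \<longrightarrow> \<eta> v = \<eta> w) \<and>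
     (\<forall>v. \<forall>i<k. linear (\<lambda>u. \<eta> (v(i := u)))) \<and>
     (\<forall>v. \<forall>i<k. \<forall>j<k. i \<noteq> j \<and> v i = v j \<longrightarrow> \<eta> v = 0)"

lemma alternating_formI:
  assumes "\<And>v w. (\<And>i. i < k \<Longrightarrow> v i = w i) \<Longrightarrow> \<eta> v = \<eta> w"
    and "\<And>v i. i < k \<Longrightarrow> linear (\<lambda>u. \<eta> (v(i := u)))"
    and "\<And>v i j. i < k \<Longrightarrow> j < k \<Longrightarrow> i \<noteq> j \<Longrightarrow> v i = v j \<Longrightarrow> \<eta> v = 0"
  shows "alternating_form k \<eta>"
  unfolding alternating_form_def using assms by blast

lemma alternating_form_cong:
  "alternating_form k \<eta> \<Longrightarrow> (\<And>i. i < k \<Longrightarrow> v i = w i) \<Longrightarrow> \<eta> v = \<eta> w"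
  by (rule alternating_form_def[THEN iffD1, THEN conjunct1, rule_format])

lemma alternating_form_linear:
  "alternating_form k \<eta> \<Longrightarrow> i < k \<Longrightarrow> linear (\<lambda>u. \<eta> (v(i := u)))"
  unfolding alternating_form_def by blast

lemma alternating_form_eq_zero:
  "alternating_form k \<eta> \<Longrightarrow> i < k \<Longrightarrow> j < k \<Longrightarrow> i \<noteq> j \<Longrightarrow> v i = v j \<Longrightarrow> \<eta> v = 0"
  unfolding alternating_form_def by blast

text \<open>Polarisation: with \<open>a + b\<close> in both slots \<open>\<eta>\<close> vanishes,
  and in the bilinear expansion the two diagonal terms vanish as well.\<close>

lemma alternating_form_swap:
  assumes "alternating_form k \<eta>" "i < k" "j < k" "i \<noteq> j"
  shows "\<eta> (v(i := a, j := b)) = - \<eta> (v(i := b, j := a))"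
proof -
  have *: "\<eta> (v(i := c, j := d + e)) = \<eta> (v(i := c, j := d)) + \<eta> (v(i := c, j := e))" for c d e
    using linear_add[OF alternating_form_linear[OF assms(1,3)]] by blast
  have **: "\<eta> (v(i := d + e, j := c)) = \<eta> (v(i := d, j := c)) + \<eta> (v(i := e, j := c))" for c d e
    using linear_add[OF alternating_form_linear[OF assms(1,2)], of "v(j := c)" d e] assms(4)
    by (simp add: fun_upd_twist)
  have z: "\<eta> (v(i := c, j := c)) = 0" for c
    by (rule alternating_form_eq_zero[OF assms]) (use assms(4) in simp)
  have "0 = \<eta> (v(i := a + b, j := a + b))" by (simp add: z)
  also have "\<dots> = \<eta> (v(i := a, j := b)) + \<eta> (v(i := b, j := a))"
    unfolding * ** by (simp add: z)
  finally show ?thesis by simp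
qed

lemma alternating_form_transpose:
  assumes "alternating_form k \<eta>" "i < k" "j < k" "i \<noteq> j"
  shows "\<eta> (\<lambda>m. v (Transposition.transpose i j m)) = - \<eta> v"
proof -
  have "(\<lambda>m. v (Transposition.transpose i j m)) = v(i := v j, j := v i)"
    by (auto simp: Transposition.transpose_def fun_eq_iff)
  then show ?thesis
    using alternating_form_swap[OF assms, of v "v j" "v i"] by simp
qed

text \<open>Induction over transpositions, each of which flips both sides. The offset
  \<open>k\<close> is there for the second factor of a wedge product, whose arguments start at
  position \<open>k\<close>.\<close>

lemma alternating_form_permute:
  assumes \<eta>: "alternating_form l \<eta>" and \<rho>: "\<rho> permutes {k..<k + l}"
  shows "\<eta> (\<lambda>i. w (\<rho> (k + i))) = of_int (sign \<rho>) * \<eta> (\<lambda>i. w (k + i))"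
  using \<rho> finite_atLeastLessThan
proof (induction arbitrary: w rule: permutes_induct)
  case id
  then show ?case by simp
next
  case (swap a b p)
  obtain i j where ij: "a = k + i" "b = k + j" "i < l" "j < l" "i \<noteq> j"
    using swap by (auto simp: le_iff_add)
  have t: "Transposition.transpose a b (k + m) = k + Transposition.transpose i j m" for m
    by (auto simp: Transposition.transpose_def ij)
  have "permutation p"
    using swap.hyps(4) finite_atLeastLessThan unfolding permutation_permutes by blast
  then have s: "sign (Transposition.transpose a b \<circ> p) = - sign p"
    using swap.hyps(3) by (simp add: sign_compose permutation_swap_id sign_swap_id)
  have "\<eta> (\<lambda>m. w (Transposition.transpose a b (p (k + m)))) = of_int (sign p) * \<eta> (\<lambda>m. w (Transposition.transpose a b (k + m)))"
    using swap.IH[of "\<lambda>x. w (Transposition.transpose a b x)"] by simp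
  also have "\<eta> (\<lambda>m. w (Transposition.transpose a b (k + m))) = - \<eta> (\<lambda>m. w (k + m))"
    unfolding t using alternating_form_transpose[OF \<eta> ij(3-5), of "\<lambda>m. w (k + m)"] by simp
  finally show ?case by (simp add: s[unfolded o_def] o_def)
qed

section \<open>Top-degree forms: one-dimensionality and trace\<close>

lemma alternating_form_zero_on_basis:
  fixes \<eta> :: "(nat \<Rightarrow> 'a::euclidean_space) \<Rightarrow> real"
  assumes \<eta>: "alternating_form DIM('a) \<eta>" and e: "bij_betw e {..<DIM('a)} Basis" and "\<eta> e = 0"
  shows "\<eta> v = 0"
proof -
  define N where "N = DIM('a)"
  note \<eta>' = \<eta>[folded N_def] and e' = e[folded N_def]
  \<comment> \<open>A sequence of basis vectors either repeats one, and alternation applies, or is a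
    rearrangement of \<open>e\<close>, and its value is plus or minus
    \<open>\<eta> e\<close>.\<close>
  have perm: "\<eta> w = 0" if w: "\<forall>i<N. w i \<in> Basis" for w
  proof (cases "inj_on w {..<N}")
    case False
    then show ?thesis
      using alternating_form_eq_zero[OF \<eta>'] unfolding inj_on_def by blast
  next
    case True
    have "w ` {..<N} = Basis"
      by (rule card_subset_eq) (use w card_image[OF True] in \<open>auto simp: N_def\<close>)
    then have w': "bij_betw w {..<N} Basis"
      using True by (simp add: bij_betw_def)
    define \<pi> where "\<pi> i = (if i < N then inv_into {..<N} e (w i) else i)" for i
    have "bij_betw (\<lambda>i. inv_into {..<N} e (w i)) {..<N} {..<N}"
      using bij_betw_trans[OF w' bij_betw_inv_into[OF e']] by (simp add: o_def)
    then have "bij_betw \<pi> {..<N} {..<N}"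
      by (rule bij_betw_cong[THEN iffD1, rotated]) (simp add: \<pi>_def)
    then have \<pi>: "\<pi> permutes {..<N}"
      by (rule bij_imp_permutes) (simp add: \<pi>_def)
    have "w i = e (\<pi> i)" if "i < N" for i
      using bij_betw_inv_into_right[OF e', of "w i"] w that by (simp add: \<pi>_def)
    then have "\<eta> w = \<eta> (\<lambda>i. e (\<pi> i))"
      by (intro alternating_form_cong[OF \<eta>']) simp
    also have "\<dots> = of_int (sign \<pi>) * \<eta> e"
      using alternating_form_permute[OF \<eta>', of \<pi> 0 e] \<pi> by (simp add: atLeast0LessThan)
    finally show ?thesis using \<open>\<eta> e = 0\<close> by simp
  qed
  \<comment> \<open>Here \<open>k\<close> counts the leading slots that may hold arbitrary vectors.
    Expanding the last of them in the basis lowers \<open>k\<close> by one; \<open>k = N\<close> is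
    the full claim.\<close>
  have "\<eta> w = 0" if "k \<le> N" "\<forall>i\<in>{k..<N}. w i \<in> Basis" for k w
    using that
  proof (induction k arbitrary: w)
    case 0
    then show ?case using perm by simp
  next
    case (Suc k)
    have l: "linear (\<lambda>u. \<eta> (w(k := u)))"
      using alternating_form_linear[OF \<eta>'] Suc.prems by simp
    have "\<eta> w = \<eta> (w(k := \<Sum>b\<in>Basis. (w k \<bullet> b) *\<^sub>R b))"
      by (simp add: euclidean_representation)
    also have "\<dots> = (\<Sum>b\<in>Basis. (w k \<bullet> b) * \<eta> (w(k := b)))"
      using linear_sum[OF l, of "\<lambda>b. (w k \<bullet> b) *\<^sub>R b" Basis] linear_cmul[OF l] by simp
    also have "\<dots> = 0"
    proof (rule sum.neutral, safe)
      fix b :: 'a assume "b \<in> Basis"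
      then have "\<eta> (w(k := b)) = 0"
        using Suc.prems by (intro Suc.IH) (auto simp: le_Suc_eq)
      then show "w k \<bullet> b * \<eta> (w(k := b)) = 0" by simp
    qed
    finally show ?case .
  qed
  from this[of N v] show ?thesis by simp
qed

lemma alternating_form_diff_cmult:
  assumes "alternating_form k \<eta>" "alternating_form k \<theta>"
  shows "alternating_form k (\<lambda>v. a * \<eta> v - b * \<theta> v)"
proof (rule alternating_formI)
  show "linear (\<lambda>u. a * \<eta> (v(i := u)) - b * \<theta> (v(i := u)))" if "i < k" for v i
    using alternating_form_linear[OF assms(1) that, of v]
      alternating_form_linear[OF assms(2) that, of v]
    by (simp add: linear_iff algebra_simps)
next
  show "a * \<eta> v - b * \<theta> v = a * \<eta> w - b * \<theta> w" if "\<And>i. i < k \<Longrightarrow> v i = w i" for v w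
    using alternating_form_cong[OF assms(1) that] alternating_form_cong[OF assms(2) that] by simp
next
  show "a * \<eta> v - b * \<theta> v = 0" if "i < k" "j < k" "i \<noteq> j" "v i = v j" for v i j
    using alternating_form_eq_zero[OF assms(1) that] alternating_form_eq_zero[OF assms(2) that]
    by simp
qed

lemma obtain_basis_enumeration:
  obtains e :: "nat \<Rightarrow> 'a::euclidean_space" where "bij_betw e {..<DIM('a)} Basis"
  using ex_bij_betw_nat_finite[OF finite_Basis] by (auto simp: atLeast0LessThan)

text \<open>The combination \<open>\<theta> e * \<eta> - \<eta> e * \<theta>\<close> vanishes on the
  basis and hence everywhere. Evaluating it at \<open>w\<close>, where both forms share a nonzero
  value, gives \<open>\<theta> e = \<eta> e\<close>.\<close>

lemma top_form_unique:
  fixes \<eta> \<theta> :: "(nat \<Rightarrow> 'a::euclidean_space) \<Rightarrow> real"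
  assumes \<eta>: "alternating_form DIM('a) \<eta>" and \<theta>: "alternating_form DIM('a) \<theta>"
    and "\<eta> w = \<theta> w" "\<eta> w \<noteq> 0"
  shows "\<eta> = \<theta>"
proof -
  obtain e :: "nat \<Rightarrow> 'a" where e: "bij_betw e {..<DIM('a)} Basis"
    by (rule obtain_basis_enumeration)
  have "\<theta> e * \<eta> w - \<eta> e * \<theta> w = 0"
    by (rule alternating_form_zero_on_basis[OF alternating_form_diff_cmult[OF \<eta> \<theta>] e]) simp
  then have eq: "\<theta> e = \<eta> e" using assms(3,4) by simp
  have "1 * \<eta> v - 1 * \<theta> v = 0" for v
    by (rule alternating_form_zero_on_basis[OF alternating_form_diff_cmult[OF \<eta> \<theta>] e])
      (simp add: eq)
  then show ?thesis by (simp add: fun_eq_iff)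
qed

text \<open>The infinitesimal form of the determinant rule. The left-hand side is again alternating
  in \<open>v\<close>, hence a multiple of \<open>\<eta>\<close>, and the factor can be read off on
  a basis.\<close>

lemma top_form_trace:
  fixes \<eta> :: "(nat \<Rightarrow> 'a::euclidean_space) \<Rightarrow> real"
  assumes \<eta>: "alternating_form DIM('a) \<eta>" and L: "linear L"
  shows "(\<Sum>i<DIM('a). \<eta> (v(i := L (v i)))) = (\<Sum>b\<in>Basis. L b \<bullet> b) * \<eta> v"
proof -
  define N where "N = DIM('a)"
  define \<theta> where "\<theta> v = (\<Sum>i<N. \<eta> (v(i := L (v i))))" for v :: "nat \<Rightarrow> 'a"
  note \<eta>' = \<eta>[folded N_def]
  note lin = alternating_form_linear[OF \<eta>']
  have \<theta>: "alternating_form N \<theta>"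
  proof (rule alternating_formI)
    fix v w :: "nat \<Rightarrow> 'a" assume "\<And>i. i < N \<Longrightarrow> v i = w i"
    then show "\<theta> v = \<theta> w"
      unfolding \<theta>_def by (intro sum.cong refl alternating_form_cong[OF \<eta>']) auto
  next
    fix v :: "nat \<Rightarrow> 'a" and k assume k: "k < N"
    have "linear (\<lambda>u. \<eta> ((v(k := u))(i := L ((v(k := u)) i))))" if i: "i < N" for i
    proof (cases "i = k")
      case True
      then show ?thesis
        using linear_compose[OF L lin[OF k, of v]] by (simp add: o_def)
    next
      case False
      then show ?thesis
        using lin[OF k, of "v(i := L (v i))"] by (simp add: fun_upd_twist)
    qed
    then show "linear (\<lambda>u. \<theta> (v(k := u)))"
      unfolding \<theta>_def by (intro linear_compose_sum) auto
  next
    fix v :: "nat \<Rightarrow> 'a" and i j assume ij: "i < N" "j < N" "i \<noteq> j" "v i = v j"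
    \<comment> \<open>A slot \<open>m\<close> other than \<open>i\<close> and \<open>j\<close>
      leaves the repeated vector in place; the two remaining terms cancel by antisymmetry.\<close>
    have "\<eta> (v(m := L (v m))) = 0" if "m < N" "m \<noteq> i" "m \<noteq> j" for m
      using that ij by (intro alternating_form_eq_zero[OF \<eta>', of i j]) auto
    then have "\<theta> v = (\<Sum>m\<in>{i, j}. \<eta> (v(m := L (v m))))"
      unfolding \<theta>_def using ij by (intro sum.mono_neutral_right) auto
    also have "\<dots> = \<eta> (v(i := L (v i), j := v i)) + \<eta> (v(i := v i, j := L (v i)))"
      using ij by (simp add: fun_upd_idem)
    also have "\<dots> = 0"
      using alternating_form_swap[OF \<eta>' ij(1-3), of v "L (v i)" "v i"] by simp
    finally show "\<theta> v = 0" .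
  qed
  obtain e :: "nat \<Rightarrow> 'a" where e: "bij_betw e {..<N} Basis"
    unfolding N_def by (rule obtain_basis_enumeration)
  have "\<eta> (e(i := L (e i))) = (L (e i) \<bullet> e i) * \<eta> e" if i: "i < N" for i
  proof -
    note l = lin[OF i, of e]
    have "\<eta> (e(i := L (e i))) = \<eta> (e(i := \<Sum>b\<in>Basis. (L (e i) \<bullet> b) *\<^sub>R b))"
      by (simp add: euclidean_representation)
    also have "\<dots> = (\<Sum>b\<in>Basis. (L (e i) \<bullet> b) * \<eta> (e(i := b)))"
      using linear_sum[OF l, of "\<lambda>b. (L (e i) \<bullet> b) *\<^sub>R b" Basis] linear_cmul[OF l] by simp
    also have "\<dots> = (\<Sum>j<N. (L (e i) \<bullet> e j) * \<eta> (e(i := e j)))"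
      by (rule sum.reindex_bij_betw[OF e, symmetric])
    \<comment> \<open>For \<open>j\<close> different from \<open>i\<close> the vector
      \<open>e j\<close> stands in both slots \<open>i\<close> and \<open>j\<close>, so only the
      diagonal entry of \<open>L\<close> survives.\<close>
    also have "\<dots> = (\<Sum>j<N. if j = i then (L (e i) \<bullet> e i) * \<eta> e else 0)"
    proof (rule sum.cong[OF refl])
      fix j assume "j \<in> {..<N}"
      then have "\<eta> (e(i := e j)) = 0" if "j \<noteq> i"
        using i that by (intro alternating_form_eq_zero[OF \<eta>', of i j]) auto
      then show "L (e i) \<bullet> e j * \<eta> (e(i := e j)) =
          (if j = i then (L (e i) \<bullet> e i) * \<eta> e else 0)"
        by auto
    qed
    finally show ?thesis using i by simp
  qed
  then have "\<theta> e = (\<Sum>i<N. L (e i) \<bullet> e i) * \<eta> e"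
    by (simp add: \<theta>_def sum_distrib_right)
  also have "(\<Sum>i<N. L (e i) \<bullet> e i) = (\<Sum>b\<in>Basis. L b \<bullet> b)"
    by (rule sum.reindex_bij_betw[OF e])
  finally have te: "\<theta> e = (\<Sum>b\<in>Basis. L b \<bullet> b) * \<eta> e" .
  have "1 * \<theta> v - (\<Sum>b\<in>Basis. L b \<bullet> b) * \<eta> v = 0"
    by (rule alternating_form_zero_on_basis[OF alternating_form_diff_cmult e[unfolded N_def]])
      (use \<theta> \<eta> te in \<open>auto simp: N_def\<close>)
  then show ?thesis by (simp add: \<theta>_def N_def)
qed

section \<open>Wedge products and powers of alternating forms\<close>

lemma alternating_form_wedge:
  fixes \<alpha> \<beta> :: "'a::real_vector form"
  assumes \<alpha>: "alternating_form k (\<alpha> q)" and \<beta>: "alternating_form l (\<beta> q)"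
  shows "alternating_form (k + l) (wedge k l \<alpha> \<beta> q)"
proof -
  define T where "T v \<sigma> = of_int (sign \<sigma>) * \<alpha> q (\<lambda>i. v (\<sigma> i)) * \<beta> q (\<lambda>i. v (\<sigma> (k + i)))"
    for v :: "nat \<Rightarrow> 'a" and \<sigma>
  define P where "P = {\<sigma>. \<sigma> permutes {..<k + l}}"
  have W: "wedge k l \<alpha> \<beta> q v = (\<Sum>\<sigma>\<in>P. T v \<sigma>) / (fact k * fact l)" for v
    by (simp add: wedge_def T_def P_def)
  show ?thesis
  proof (rule alternating_formI)
    fix v w :: "nat \<Rightarrow> 'a" assume vw: "\<And>i. i < k + l \<Longrightarrow> v i = w i"
    have "T v \<sigma> = T w \<sigma>" if "\<sigma> \<in> P" for \<sigma>
    proof -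
      have s: "v (\<sigma> i) = w (\<sigma> i)" if "i < k + l" for i
        using \<open>\<sigma> \<in> P\<close> that permutes_in_image[of \<sigma> "{..<k + l}" i] by (intro vw) (simp add: P_def)
      have "\<alpha> q (\<lambda>i. v (\<sigma> i)) = \<alpha> q (\<lambda>i. w (\<sigma> i))"
        "\<beta> q (\<lambda>i. v (\<sigma> (k + i))) = \<beta> q (\<lambda>i. w (\<sigma> (k + i)))"
        by (auto intro!: alternating_form_cong[OF \<alpha>] alternating_form_cong[OF \<beta>] s)
      then show ?thesis by (simp add: T_def)
    qed
    then show "wedge k l \<alpha> \<beta> q v = wedge k l \<alpha> \<beta> q w"
      by (simp add: W)
  next
    fix v :: "nat \<Rightarrow> 'a" and j assume j: "j < k + l"
    have "linear (\<lambda>u. T (v(j := u)) \<sigma>)" if "\<sigma> \<in> P" for \<sigma>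
    proof -
      have \<sigma>: "\<sigma> permutes {..<k + l}" using that by (simp add: P_def)
      \<comment> \<open>The vector \<open>v j\<close> enters the term of \<open>\<sigma>\<close>
        only at position \<open>m\<close>: as an argument of \<open>\<alpha>\<close> if
        \<open>m < k\<close>, and otherwise as argument \<open>m - k\<close> of
        \<open>\<beta>\<close>.\<close>
      define m where "m = inv \<sigma> j"
      have m: "m < k + l"
        using permutes_in_image[OF permutes_inv[OF \<sigma>], of j] j by (simp add: m_def)
      have eq: "\<sigma> i = j \<longleftrightarrow> i = m" for i
        using permutes_inverses[OF \<sigma>] by (auto simp: m_def)
      show ?thesis
      proof (cases "m < k")
        case True
        have "(\<lambda>i. (v(j := u)) (\<sigma> i)) = (\<lambda>i. v (\<sigma> i))(m := u)"
          "(\<lambda>i. (v(j := u)) (\<sigma> (k + i))) = (\<lambda>i. v (\<sigma> (k + i)))" for u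
          using True by (auto simp: fun_eq_iff eq)
        then have "T (v(j := u)) \<sigma> = of_int (sign \<sigma>) * \<alpha> q ((\<lambda>i. v (\<sigma> i))(m := u)) *
            \<beta> q (\<lambda>i. v (\<sigma> (k + i)))" for u
          unfolding T_def by (simp only:)
        then show ?thesis
          using alternating_form_linear[OF \<alpha> True, of "\<lambda>i. v (\<sigma> i)"]
          by (simp add: linear_iff algebra_simps)
      next
        case False
        have "(\<lambda>i. (v(j := u)) (\<sigma> (k + i))) = (\<lambda>i. v (\<sigma> (k + i)))(m - k := u)" for u
          using False by (auto simp: fun_eq_iff eq)
        moreover have "\<alpha> q (\<lambda>i. (v(j := u)) (\<sigma> i)) = \<alpha> q (\<lambda>i. v (\<sigma> i))" for u
          using False by (intro alternating_form_cong[OF \<alpha>]) (auto simp: eq)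
        ultimately have "T (v(j := u)) \<sigma> = of_int (sign \<sigma>) * \<alpha> q (\<lambda>i. v (\<sigma> i)) *
            \<beta> q ((\<lambda>i. v (\<sigma> (k + i)))(m - k := u))" for u
          unfolding T_def by (simp only:)
        moreover have "m - k < l" using m False by simp
        ultimately show ?thesis
          using alternating_form_linear[OF \<beta>, of "m - k" "\<lambda>i. v (\<sigma> (k + i))"]
          by (simp add: linear_iff algebra_simps)
      qed
    qed
    then have "linear (\<lambda>u. \<Sum>\<sigma>\<in>P. T (v(j := u)) \<sigma>)"
      by (intro linear_compose_sum) auto
    then show "linear (\<lambda>u. wedge k l \<alpha> \<beta> q (v(j := u)))"
      unfolding W by (simp add: linear_iff add_divide_distrib)
  next
    fix v :: "nat \<Rightarrow> 'a" and i j assume ij: "i < k + l" "j < k + l" "i \<noteq> j" "v i = v j"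
    have v: "v (Transposition.transpose i j m) = v m" for m
      using ij(4) by (simp add: Transposition.transpose_def)
    have t: "Transposition.transpose i j permutes {..<k + l}"
      using ij by (intro permutes_swap_id) auto
    have inv: "Transposition.transpose i j \<circ> (Transposition.transpose i j \<circ> \<sigma>) = \<sigma>" for \<sigma> :: "nat \<Rightarrow> nat"
      by (simp add: fun_eq_iff)
    \<comment> \<open>Since \<open>v i = v j\<close>, composing with the transposition changes only
      the sign of a term, so the reindexed sum equals its own negative.\<close>
    have "bij_betw ((\<circ>) (Transposition.transpose i j)) P P"
      by (rule bij_betw_byWitness[where f' = "(\<circ>) (Transposition.transpose i j)"])
        (use permutes_compose[OF _ t] in \<open>auto simp: inv P_def\<close>)
    then have "(\<Sum>\<sigma>\<in>P. T v \<sigma>) = (\<Sum>\<sigma>\<in>P. T v (Transposition.transpose i j \<circ> \<sigma>))"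
      by (rule sum.reindex_bij_betw[symmetric])
    also have "\<dots> = (\<Sum>\<sigma>\<in>P. - T v \<sigma>)"
    proof (rule sum.cong[OF refl])
      fix \<sigma> assume "\<sigma> \<in> P"
      then have "permutation \<sigma>"
        unfolding P_def permutation_permutes using finite_lessThan by blast
      then have "sign (Transposition.transpose i j \<circ> \<sigma>) = - sign \<sigma>"
        using ij(3) by (simp add: sign_compose permutation_swap_id sign_swap_id)
      then show "T v (Transposition.transpose i j \<circ> \<sigma>) = - T v \<sigma>"
        by (simp add: T_def v)
    qed
    also have "\<dots> = - (\<Sum>\<sigma>\<in>P. T v \<sigma>)" by (rule sum_negf)
    finally show "wedge k l \<alpha> \<beta> q v = 0" by (simp add: W)
  qed
qed

lemma alternating_form_wedge_power:
  assumes "alternating_form k (\<omega> q)"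
  shows "alternating_form (m * k) (wedge_power k \<omega> m q)"
proof (induction m)
  case 0
  show ?case by (rule alternating_formI) auto
next
  case (Suc m)
  then show ?case using alternating_form_wedge[of k \<omega> q] assms by simp
qed

section \<open>The contact volume form\<close>

text \<open>The Gram matrix of a symplectic basis in interleaved order: each vector at an even
  position is conjugate to its successor, and all other pairings vanish.\<close>

definition symplectic_sequence :: "('a \<Rightarrow> 'a \<Rightarrow> real) \<Rightarrow> nat \<Rightarrow> (nat \<Rightarrow> 'a) \<Rightarrow> bool" where
  "symplectic_sequence B m v \<longleftrightarrow> (\<forall>i<m * 2. \<forall>j<m * 2. B (v i) (v j) =
     (if even i \<and> j = Suc i then 1 else if even j \<and> i = Suc j then - 1 else 0))"

text \<open>A permutation contributes only if its first two values form a conjugate pair. Each such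
  term equals the constant of the previous power, because the sign of the permutation enters twice,
  so nothing cancels.\<close>

lemma wedge_power_symplectic_sequence:
  fixes \<omega> :: "'a::real_vector form"
  assumes \<omega>: "\<And>q v. \<omega> q v = B (v 0) (v 1)" and alt: "\<And>q. alternating_form 2 (\<omega> q)"
  shows "\<exists>c>0. \<forall>q v. symplectic_sequence B m v \<longrightarrow> wedge_power 2 \<omega> m q v = c"
proof (induction m)
  case 0
  show ?case by (intro exI[of _ 1]) simp
next
  case (Suc m)
  then obtain c where "c > 0"
    and c: "\<And>q v. symplectic_sequence B m v \<Longrightarrow> wedge_power 2 \<omega> m q v = c" by blast
  define W where "W = wedge_power 2 \<omega> m"
  have altW: "alternating_form (m * 2) (W q)" for q
    unfolding W_def by (rule alternating_form_wedge_power) (rule alt)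
  define S where "S = {\<sigma>. \<sigma> permutes {..<2 + m * 2}}"
  have fin: "finite S"
    unfolding S_def by (intro finite_permutations finite_lessThan)
  define up where "up \<sigma> \<longleftrightarrow> even (\<sigma> 0) \<and> \<sigma> (Suc 0) = Suc (\<sigma> 0)" for \<sigma> :: "nat \<Rightarrow> nat"
  define down where "down \<sigma> \<longleftrightarrow> even (\<sigma> (Suc 0)) \<and> \<sigma> 0 = Suc (\<sigma> (Suc 0))" for \<sigma> :: "nat \<Rightarrow> nat"
  define T where "T q v \<sigma> = of_int (sign \<sigma>) * B (v (\<sigma> 0)) (v (\<sigma> (Suc 0))) * W q (\<lambda>i. v (\<sigma> (2 + i)))"
    for q v and \<sigma> :: "nat \<Rightarrow> nat"
  have wedge: "wedge_power 2 \<omega> (Suc m) q v = (\<Sum>\<sigma>\<in>S. T q v \<sigma>) / (fact 2 * fact (m * 2))" for q v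
    by (simp add: wedge_def T_def S_def \<omega> W_def)
  have T_up: "T q v \<sigma> = c"
    if v: "symplectic_sequence B (Suc m) v" and \<sigma>: "\<sigma> \<in> S" and up: "up \<sigma>" for q v \<sigma>
  proof -
    have \<sigma>': "\<sigma> permutes {..<2 + m * 2}" using \<sigma> by (simp add: S_def)
    define a where "a = \<sigma> 0"
    have a: "even a" "\<sigma> (Suc 0) = Suc a" using up by (simp_all add: up_def a_def)
    have a': "Suc a < 2 + m * 2"
      using permutes_in_image[OF \<sigma>', of "Suc 0"] a(2) by simp
    \<comment> \<open>\<open>\<tau>\<close> exchanges the pairs \<open>(a, a + 1)\<close> and \<open>(0, 1)\<close>; being even and mapping symplectic
      sequences to such, it reduces the claim to \<open>a = 0\<close> without any sign bookkeeping.\<close>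
    define \<tau> where "\<tau> = Transposition.transpose 0 a \<circ> Transposition.transpose (Suc 0) (Suc a)"
    have \<tau>: "\<tau> i = (if i = 0 then a else if i = Suc 0 then Suc a else if i = a then 0
        else if i = Suc a then Suc 0 else i)" for i
      using a(1) by (auto simp: \<tau>_def Transposition.transpose_def)
    have inv: "\<tau> (\<tau> i) = i" for i
      using a(1) by (auto simp: \<tau>)
    have \<tau>p: "\<tau> permutes {..<2 + m * 2}"
      unfolding \<tau>_def using a' by (intro permutes_compose permutes_swap_id) auto
    have sign_\<tau>: "sign \<tau> = 1"
      by (simp add: \<tau>_def sign_compose permutation_swap_id sign_swap_id)
    define \<rho> where "\<rho> = \<tau> \<circ> \<sigma>"
    have "\<rho> permutes {..<2 + m * 2}"
      unfolding \<rho>_def by (rule permutes_compose[OF \<sigma>' \<tau>p])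
    moreover have "\<rho> 0 = 0" "\<rho> (Suc 0) = Suc 0"
      using a by (auto simp: \<rho>_def a_def[symmetric] \<tau>)
    ultimately have \<rho>: "\<rho> permutes {2..<2 + m * 2}"
      by (elim permutes_superset) (auto simp: less_2_cases_iff not_le)
    have "permutation \<sigma>" "permutation \<tau>"
      using \<sigma>' \<tau>p finite_lessThan unfolding permutation_permutes by blast+
    then have sign_\<rho>: "sign \<rho> = sign \<sigma>"
      by (simp add: \<rho>_def sign_compose sign_\<tau>)
    have "\<sigma> i = \<tau> (\<rho> i)" for i by (simp add: \<rho>_def inv)
    then have "W q (\<lambda>i. v (\<sigma> (2 + i))) = W q (\<lambda>i. v (\<tau> (\<rho> (2 + i))))" by simp
    also have "\<dots> = of_int (sign \<rho>) * W q (\<lambda>i. v (\<tau> (2 + i)))"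
      using alternating_form_permute[OF altW \<rho>, where w = "\<lambda>i. v (\<tau> i)"] by simp
    also have "W q (\<lambda>i. v (\<tau> (2 + i))) = c"
      unfolding W_def
    proof (rule c, unfold symplectic_sequence_def, intro allI impI)
      fix i j assume ij: "i < m * 2" "j < m * 2"
      have lt: "\<tau> (2 + i) < Suc m * 2" "\<tau> (2 + j) < Suc m * 2"
        using ij a' by (auto simp: \<tau>)
      have "B (v (\<tau> (2 + i))) (v (\<tau> (2 + j))) =
          (if even (\<tau> (2 + i)) \<and> \<tau> (2 + j) = Suc (\<tau> (2 + i)) then 1
           else if even (\<tau> (2 + j)) \<and> \<tau> (2 + i) = Suc (\<tau> (2 + j)) then - 1 else 0)"
        using v lt unfolding symplectic_sequence_def by blast
      moreover have "even (\<tau> (2 + i)) \<and> \<tau> (2 + j) = Suc (\<tau> (2 + i)) \<longleftrightarrow> even i \<and> j = Suc i" for i j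
        using a(1) by (auto simp: \<tau>)
      ultimately show "B (v (\<tau> (2 + i))) (v (\<tau> (2 + j))) =
          (if even i \<and> j = Suc i then 1 else if even j \<and> i = Suc j then - 1 else 0)"
        by (simp only:)
    qed
    finally have "W q (\<lambda>i. v (\<sigma> (2 + i))) = of_int (sign \<sigma>) * c" by (simp add: sign_\<rho>)
    moreover have "B (v (\<sigma> 0)) (v (\<sigma> (Suc 0))) = 1"
      using v a a' by (simp add: symplectic_sequence_def a_def[symmetric])
    moreover have "of_int (sign \<sigma>) * of_int (sign \<sigma>) = (1::real)"
      by (simp flip: of_int_mult)
    ultimately show ?thesis by (simp add: T_def mult.assoc[symmetric])
  qed
  have T_down: "T q v \<sigma> = c"
    if v: "symplectic_sequence B (Suc m) v" and \<sigma>: "\<sigma> \<in> S" and down: "down \<sigma>" for q v \<sigma>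
  proof -
    \<comment> \<open>Exchanging the first two positions reverses both the sign of the permutation
      and the value of \<open>B\<close>, which reduces this case to \<open>T_up\<close>.\<close>
    define \<sigma>' where "\<sigma>' = \<sigma> \<circ> Transposition.transpose 0 (Suc 0)"
    have \<sigma>'_S: "\<sigma>' \<in> S"
      using \<sigma> unfolding S_def \<sigma>'_def by (auto intro!: permutes_compose permutes_swap_id)
    have s0: "\<sigma>' 0 = \<sigma> (Suc 0)" "\<sigma>' (Suc 0) = \<sigma> 0" "\<sigma>' (2 + i) = \<sigma> (2 + i)" for i
      by (auto simp: \<sigma>'_def Transposition.transpose_def)
    have "permutation \<sigma>"
      using \<sigma> finite_lessThan unfolding S_def permutation_permutes by blast
    then have sg: "sign \<sigma>' = - sign \<sigma>"
      by (simp add: \<sigma>'_def sign_compose permutation_swap_id sign_swap_id)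
    have "B (v (\<sigma> 0)) (v (\<sigma> (Suc 0))) = - B (v (\<sigma> (Suc 0))) (v (\<sigma> 0))"
      using alternating_form_transpose[OF alt[of q], of 0 "Suc 0" "\<lambda>i. v (\<sigma> i)"] by (simp add: \<omega>)
    then have "T q v \<sigma> = T q v \<sigma>'"
      by (simp only: T_def s0 sg)
    also have "\<dots> = c"
      using T_up[OF v \<sigma>'_S, of q] down by (simp add: up_def down_def s0)
    finally show ?thesis .
  qed
  define P where "P = {\<sigma> \<in> S. up \<sigma> \<or> down \<sigma>}"
  \<comment> \<open>At least one permutation contributes, so positivity passes from \<open>c\<close>
    to the next power.\<close>
  have "id \<in> P" by (simp add: P_def S_def up_def permutes_id)
  then have cP: "card P > 0"
    using fin by (auto simp: P_def card_gt_0_iff)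
  have "(\<Sum>\<sigma>\<in>S. T q v \<sigma>) = of_nat (card P) * c" if v: "symplectic_sequence B (Suc m) v" for q v
  proof -
    have "T q v \<sigma> = 0" if "\<sigma> \<in> S - P" for \<sigma>
    proof -
      have \<sigma>: "\<sigma> permutes {..<2 + m * 2}" "\<not> up \<sigma>" "\<not> down \<sigma>"
        using that by (auto simp: P_def S_def)
      have "\<sigma> 0 < Suc m * 2" "\<sigma> (Suc 0) < Suc m * 2"
        using permutes_in_image[OF \<sigma>(1), of 0] permutes_in_image[OF \<sigma>(1), of "Suc 0"] by auto
      then have "B (v (\<sigma> 0)) (v (\<sigma> (Suc 0))) = 0"
        using v \<sigma>(2,3) unfolding symplectic_sequence_def up_def down_def by auto
      then show ?thesis by (simp add: T_def)
    qed
    then have "(\<Sum>\<sigma>\<in>S. T q v \<sigma>) = (\<Sum>\<sigma>\<in>P. T q v \<sigma>)"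
      using fin by (intro sum.mono_neutral_right) (auto simp: P_def)
    also have "\<dots> = (\<Sum>\<sigma>\<in>P. c)"
      by (rule sum.cong[OF refl]) (use T_up[OF v, of _ q] T_down[OF v, of _ q] in \<open>auto simp: P_def\<close>)
    finally show ?thesis by simp
  qed
  then show ?case
    using \<open>c > 0\<close> cP unfolding wedge
    by (intro exI[of _ "of_nat (card P) * c / (fact 2 * fact (m * 2))"]) simp
qed

text \<open>In each term of the outer wedge product the kernel vector \<open>u\<close> is fed either
  to \<open>\<omega>\<close> or to the lower power, where the induction hypothesis applies.\<close>

lemma wedge_power_degenerate:
  fixes \<omega> :: "'a::real_vector form"
  assumes \<omega>: "\<And>v. \<omega> q v = B (v 0) (v 1)"
    and u: "\<And>w. B u w = 0" "\<And>w. B w u = 0"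
    and "i < m * 2" "v i = u"
  shows "wedge_power 2 \<omega> m q v = 0"
  using assms(4,5)
proof (induction m arbitrary: v i)
  case 0
  then show ?case by simp
next
  case (Suc m)
  have "\<omega> q (\<lambda>i. v (\<sigma> i)) * wedge_power 2 \<omega> m q (\<lambda>i. v (\<sigma> (2 + i))) = 0"
    if \<sigma>: "\<sigma> permutes {..<2 + m * 2}" for \<sigma>
  proof -
    define j where "j = inv \<sigma> i"
    have j: "j < 2 + m * 2" "\<sigma> j = i"
      using permutes_in_image[OF permutes_inv[OF \<sigma>], of i] Suc.prems(1) permutes_inverses[OF \<sigma>]
      by (auto simp: j_def)
    consider "j = 0" | "j = 1" | "j = 2 + (j - 2)" "j - 2 < m * 2"
      using j(1) by linarith
    then show ?thesis
    proof cases
      case 3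
      then have "wedge_power 2 \<omega> m q (\<lambda>i. v (\<sigma> (2 + i))) = 0"
        using Suc.IH[of "j - 2" "\<lambda>i. v (\<sigma> (2 + i))"] j(2) Suc.prems(2) by simp
      then show ?thesis by simp
    qed (use j(2) Suc.prems(2) u in \<open>auto simp: \<omega>\<close>)
  qed
  then have "(\<Sum>\<sigma> | \<sigma> permutes {..<2 + m * 2}. of_int (sign \<sigma>) * \<omega> q (\<lambda>i. v (\<sigma> i)) *
      wedge_power 2 \<omega> m q (\<lambda>i. v (\<sigma> (2 + i)))) = 0"
    by (intro sum.neutral) (simp add: mult.assoc)
  then show ?case by (simp add: wedge_def)
qed

section \<open>The contact form, its differential and its volume form\<close>

lemma alternating_form_contact_form:
  "alternating_form 1 (contact_form (q :: 'n::finite phase))"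
proof (rule alternating_formI)
  fix v :: "nat \<Rightarrow> 'n phase" and i :: nat assume "i < 1"
  then show "linear (\<lambda>u. contact_form q (v(i := u)))"
    by (cases q) (simp add: contact_form_def linear_iff case_prod_beta algebra_simps
        sum.distrib sum_distrib_left)
qed (auto simp: contact_form_def case_prod_beta)

lemma alternating_form_ext_deriv_contact_form:
  "alternating_form 2 (ext_deriv 1 contact_form (q :: 'n::finite phase))"
proof (rule alternating_formI)
  fix v :: "nat \<Rightarrow> 'n phase" and i :: nat assume "i < 2"
  then consider "i = 0" | "i = 1" by linarith
  then show "linear (\<lambda>u. ext_deriv 1 contact_form q (v(i := u)))"
    by cases (simp_all add: ext_deriv_contact_form[unfolded One_nat_def] linear_iff algebra_simps
        sum.distrib sum_distrib_left sum_subtractf)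
next
  fix v :: "nat \<Rightarrow> 'n phase" and i j :: nat
  assume "i < 2" "j < 2" "i \<noteq> j" "v i = v j"
  then have "v 0 = v 1" by (auto simp: less_2_cases_iff)
  then show "ext_deriv 1 contact_form q v = 0"
    by (simp add: ext_deriv_contact_form[unfolded One_nat_def] mult.commute)
qed (simp add: ext_deriv_contact_form[unfolded One_nat_def])

lemma alternating_form_contact_volume:
  "alternating_form DIM('n phase) (contact_volume (q :: 'n::finite phase))"
proof -
  have "alternating_form (1 + CARD('n) * 2) (contact_volume q)"
    unfolding contact_volume_def
    by (intro alternating_form_wedge alternating_form_wedge_power
        alternating_form_contact_form alternating_form_ext_deriv_contact_form)
  moreover have "DIM('n phase) = 1 + CARD('n) * 2" by simp
  ultimately show ?thesis by metis
qed

text \<open>Evaluate on the Reeb vector followed by a symplectic basis for d\<lambda>. The Reeb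
  vector lies in the kernel of d\<lambda>, so only permutations fixing \<open>0\<close> count. In
  them \<lambda> meets just the Reeb vector, where it is 1, and the dependence on \<open>q\<close>
  through \<open>p\<close> never appears.\<close>

lemma contact_volume_basis_value:
  "\<exists>w. \<exists>c>0. \<forall>q :: 'n::finite phase. contact_volume q w = c"
proof -
  define B where "B u w = (\<Sum>a\<in>UNIV. fst u $ a * fst (snd w) $ a - fst (snd u) $ a * fst w $ a)"
    for u w :: "'n phase"
  define \<omega> where "\<omega> = (ext_deriv 1 contact_form :: 'n phase form)"
  have \<omega>: "\<omega> q v = B (v 0) (v 1)" for q v
    unfolding \<omega>_def B_def by (rule ext_deriv_contact_form)
  have alt: "alternating_form 2 (\<omega> q)" for q
    unfolding \<omega>_def by (rule alternating_form_ext_deriv_contact_form)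
  obtain e where e: "bij_betw e {..<CARD('n)} (UNIV :: 'n set)"
    using ex_bij_betw_nat_finite[OF finite_class.finite_UNIV] by (auto simp: atLeast0LessThan)
  \<comment> \<open>The coordinate directions of \<open>x\<close> and \<open>p\<close> alternate,
    \<open>x\<close> first, in agreement with the sign in d\<lambda> = dx \<and> dp.\<close>
  define b :: "nat \<Rightarrow> 'n phase" where
    "b i = (if even i then (axis (e (i div 2)) 1, 0, 0) else (0, axis (e (i div 2)) 1, 0))" for i
  define w :: "nat \<Rightarrow> 'n phase" where "w = case_nat (0, 0, 1) b"
  have eq: "e i = e j \<longleftrightarrow> i = j" if "i < CARD('n)" "j < CARD('n)" for i j
    using e that by (auto simp: bij_betw_def inj_on_def)
  have ax: "(\<Sum>a\<in>UNIV. axis i (1::real) $ a * axis j 1 $ a) = (if i = j then 1 else 0)" for i j :: 'n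
    using inner_axis_axis[of i "1::real" j 1] by (simp add: inner_vec_def)
  have symp: "symplectic_sequence B CARD('n) b"
    unfolding symplectic_sequence_def
  proof (intro allI impI)
    fix i j assume ij: "i < CARD('n) * 2" "j < CARD('n) * 2"
    have "e (i div 2) = e (j div 2) \<longleftrightarrow> i div 2 = j div 2"
      using ij by (intro eq) auto
    moreover have "even i \<Longrightarrow> odd j \<Longrightarrow> i div 2 = j div 2 \<longleftrightarrow> j = Suc i"
      "even j \<Longrightarrow> odd i \<Longrightarrow> i div 2 = j div 2 \<longleftrightarrow> i = Suc j"
      by (auto elim!: evenE oddE)
    ultimately show "B (b i) (b j) =
        (if even i \<and> j = Suc i then 1 else if even j \<and> i = Suc j then - 1 else 0)"
      by (auto simp: B_def b_def ax sum_negf)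
  qed
  define W where "W = wedge_power 2 \<omega> CARD('n)"
  have altW: "alternating_form (CARD('n) * 2) (W q)" for q
    unfolding W_def by (rule alternating_form_wedge_power) (rule alt)
  obtain c where "c > 0" and c: "\<And>q. W q b = c"
    using wedge_power_symplectic_sequence[of \<omega> B "CARD('n)"] \<omega> alt symp
    unfolding W_def by blast
  define S where "S = {\<sigma>. \<sigma> permutes {..<1 + CARD('n) * 2}}"
  define P where "P = {\<sigma> \<in> S. \<sigma> 0 = 0}"
  have fin: "finite S"
    unfolding S_def by (intro finite_permutations finite_lessThan)
  have "id \<in> P" by (simp add: P_def S_def permutes_id)
  then have cP: "card P > 0"
    using fin by (auto simp: P_def card_gt_0_iff)
  have "contact_volume q w = of_nat (card P) * c / (fact 1 * fact (CARD('n) * 2))" for q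
  proof -
    define T where "T \<sigma> = of_int (sign \<sigma>) * contact_form q (\<lambda>i. w (\<sigma> i)) * W q (\<lambda>i. w (\<sigma> (1 + i)))"
      for \<sigma> :: "nat \<Rightarrow> nat"
    have "T \<sigma> = c" if "\<sigma> \<in> P" for \<sigma>
    proof -
      have \<sigma>: "\<sigma> permutes {..<1 + CARD('n) * 2}" "\<sigma> 0 = 0"
        using that by (auto simp: P_def S_def)
      have "\<sigma> permutes {1..<1 + CARD('n) * 2}"
        by (rule permutes_superset[OF \<sigma>(1)]) (auto simp: \<sigma>(2) not_le)
      then have "W q (\<lambda>i. w (\<sigma> (1 + i))) = of_int (sign \<sigma>) * W q (\<lambda>i. w (1 + i))"
        by (rule alternating_form_permute[OF altW])
      also have "(\<lambda>i. w (1 + i)) = b" by (simp add: w_def)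
      finally have "W q (\<lambda>i. w (\<sigma> (1 + i))) = of_int (sign \<sigma>) * c" by (simp only: c)
      moreover have "contact_form q (\<lambda>i. w (\<sigma> i)) = 1"
        by (simp add: contact_form_def case_prod_beta \<sigma>(2) w_def)
      moreover have "of_int (sign \<sigma>) * of_int (sign \<sigma>) = (1::real)"
        by (simp flip: of_int_mult)
      ultimately show ?thesis by (simp add: T_def mult.assoc[symmetric])
    qed
    moreover have "T \<sigma> = 0" if "\<sigma> \<in> S - P" for \<sigma>
    proof -
      have \<sigma>: "\<sigma> permutes {..<1 + CARD('n) * 2}" "\<sigma> 0 \<noteq> 0"
        using that by (auto simp: P_def S_def)
      define j where "j = inv \<sigma> 0"
      have j: "j < 1 + CARD('n) * 2" "\<sigma> j = 0"
        using permutes_in_image[OF permutes_inv[OF \<sigma>(1)], of 0] permutes_inverses[OF \<sigma>(1)]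
        by (auto simp: j_def)
      then obtain i where i: "j = 1 + i" using \<sigma>(2) by (cases j) auto
      \<comment> \<open>The Reeb vector now occupies slot \<open>i\<close> of the power of
        d\<lambda>.\<close>
      have "W q (\<lambda>i. w (\<sigma> (1 + i))) = 0"
        unfolding W_def
        by (rule wedge_power_degenerate[where B = B and i = i and u = "(0, 0, 1)"])
          (use i j in \<open>auto simp: \<omega> B_def w_def\<close>)
      then show ?thesis by (simp add: T_def)
    qed
    ultimately have "(\<Sum>\<sigma>\<in>S. T \<sigma>) = (\<Sum>\<sigma>\<in>P. c)"
      using fin by (intro sum.mono_neutral_cong_right) (auto simp: P_def)
    then show ?thesis
      by (simp add: contact_volume_def wedge_def T_def S_def W_def \<omega>_def)
  qed
  moreover have "of_nat (card P) * c / (fact 1 * fact (CARD('n) * 2)) > 0"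
    using \<open>c > 0\<close> cP by simp
  ultimately show ?thesis by blast
qed

text \<open>Two top-degree forms that agree on one sequence with nonzero value coincide. This is
  what reduces invariance to a condition on a scalar density.\<close>

lemma contact_volume_constant: "contact_volume q = contact_volume (r :: 'n::finite phase)"
proof -
  obtain w c where "c > 0" "\<And>q :: 'n phase. contact_volume q w = c"
    using contact_volume_basis_value by blast
  then show ?thesis
    by (intro top_form_unique[of _ _ w] alternating_form_contact_volume) auto
qed

lemma contact_volume_nonzero: "\<exists>w. contact_volume (q :: 'n::finite phase) w \<noteq> 0"
  using contact_volume_basis_value by (metis less_irrefl)

section \<open>Calculus of smooth functions\<close>

text \<open>On an open set agreement of functions passes to their derivatives, so the recursion of
  \<open>Ck_on\<close> can be followed.\<close>

lemma Ck_on_cong: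
  assumes "open S" "\<And>x. x \<in> S \<Longrightarrow> f x = g x" "Ck_on k S f"
  shows "Ck_on k S g"
  using assms(2,3)
proof (induction k arbitrary: f g)
  case 0
  then show ?case using continuous_on_cong[of S S f g] by simp
next
  case (Suc k)
  have d: "f differentiable at x" if "x \<in> S" for x
    using Suc.prems(2) that by simp
  have eq: "frechet_derivative f (at x) = frechet_derivative g (at x)" if "x \<in> S" for x
    using d[OF that] assms(1) that Suc.prems(1) by (rule frechet_derivative_transform_within_open)
  have "g differentiable at x" if "x \<in> S" for x
    using d[OF that] that assms(1) Suc.prems(1) unfolding differentiable_def
    by (metis has_derivative_transform_within_open)
  moreover have "Ck_on k S (\<lambda>x. frechet_derivative g (at x) v)" for v
    by (rule Suc.IH[of "\<lambda>x. frechet_derivative f (at x) v"]) (use eq Suc.prems(2) in auto)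
  ultimately show ?case by simp
qed

lemma Ck_on_SucD: "Ck_on (Suc k) S f \<Longrightarrow> Ck_on k S f"
proof (induction k arbitrary: f)
  case 0
  then show ?case
    by (simp add: differentiable_at_imp_differentiable_on differentiable_imp_continuous_on)
next
  case (Suc k)
  then show ?case by (metis Ck_on.simps(2))
qed

text \<open>Allows any known formula for the derivative on \<open>S\<close> in place of
  \<open>frechet_derivative\<close>; the closure properties below are inductions through this
  rule.\<close>

lemma Ck_on_SucI:
  assumes "open S" "\<And>x. x \<in> S \<Longrightarrow> (f has_derivative f' x) (at x)"
    and "\<And>v. Ck_on k S (\<lambda>x. f' x v)"
  shows "Ck_on (Suc k) S f"
proof -
  have eq: "f' x = frechet_derivative f (at x)" if "x \<in> S" for x
    using frechet_derivative_at[OF assms(2)[OF that]] .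
  have "Ck_on k S (\<lambda>x. frechet_derivative f (at x) v)" for v
    by (rule Ck_on_cong[OF assms(1) _ assms(3)[of v]]) (simp add: eq)
  then show ?thesis
    using assms(2) by (auto intro: differentiableI)
qed

lemma Ck_on_Suc_has_derivative:
  "Ck_on (Suc k) S f \<Longrightarrow> x \<in> S \<Longrightarrow> (f has_derivative frechet_derivative f (at x)) (at x)"
  by (simp add: frechet_derivative_works)

lemma Ck_on_const: "Ck_on k S (\<lambda>_. c)"
  by (induction k arbitrary: c) auto

lemma Ck_on_bounded_linear:
  assumes "open S" "bounded_linear L" shows "Ck_on k S L"
proof (cases k)
  case 0
  then show ?thesis using linear_continuous_on[OF assms(2)] by simp
next
  case (Suc j)
  then show ?thesis
    using assms bounded_linear_imp_has_derivative[OF assms(2)]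
    by (auto intro!: Ck_on_SucI[where f' = "\<lambda>_. L"] Ck_on_const simp del: Ck_on.simps)
qed

lemma Ck_on_compose_bounded_linear:
  assumes "open S" "bounded_linear L" "Ck_on k S f"
  shows "Ck_on k S (\<lambda>x. L (f x))"
  using assms(3)
proof (induction k arbitrary: f)
  case 0
  then show ?case using bounded_linear.continuous_on[OF assms(2)] by simp
next
  case (Suc k)
  show ?case
  proof (rule Ck_on_SucI[OF assms(1)])
    show "((\<lambda>x. L (f x)) has_derivative (\<lambda>v. L (frechet_derivative f (at x) v))) (at x)"
      if "x \<in> S" for x
      using bounded_linear.has_derivative[OF assms(2) Ck_on_Suc_has_derivative[OF Suc.prems that]] .
    show "Ck_on k S (\<lambda>x. L (frechet_derivative f (at x) v))" for v
      using Suc by simp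
  qed
qed

lemma Ck_on_add:
  assumes "open S" "Ck_on k S f" "Ck_on k S g"
  shows "Ck_on k S (\<lambda>x. f x + g x)"
  using assms(2,3)
proof (induction k arbitrary: f g)
  case 0
  then show ?case by (simp add: continuous_on_add)
next
  case (Suc k)
  show ?case
  proof (rule Ck_on_SucI[OF assms(1)])
    show "((\<lambda>x. f x + g x) has_derivative
        (\<lambda>v. frechet_derivative f (at x) v + frechet_derivative g (at x) v)) (at x)" if "x \<in> S" for x
      using has_derivative_add[OF Ck_on_Suc_has_derivative[OF Suc.prems(1) that]
          Ck_on_Suc_has_derivative[OF Suc.prems(2) that]] .
    show "Ck_on k S (\<lambda>x. frechet_derivative f (at x) v + frechet_derivative g (at x) v)" for v
      using Suc.prems by (intro Suc.IH) simp_all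
  qed
qed

lemma Ck_on_mult:
  fixes f g :: "'a::euclidean_space \<Rightarrow> real"
  assumes "open S" "Ck_on k S f" "Ck_on k S g"
  shows "Ck_on k S (\<lambda>x. f x * g x)"
  using assms(2,3)
proof (induction k arbitrary: f g)
  case 0
  then show ?case by (simp add: continuous_on_mult)
next
  case (Suc k)
  show ?case
  proof (rule Ck_on_SucI[OF assms(1)])
    show "((\<lambda>x. f x * g x) has_derivative
        (\<lambda>v. f x * frechet_derivative g (at x) v + frechet_derivative f (at x) v * g x)) (at x)"
      if "x \<in> S" for x
      using has_derivative_mult[OF Ck_on_Suc_has_derivative[OF Suc.prems(1) that]
          Ck_on_Suc_has_derivative[OF Suc.prems(2) that]] .
    show "Ck_on k S (\<lambda>x. f x * frechet_derivative g (at x) v + frechet_derivative f (at x) v * g x)" for v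
      using Suc.prems Suc.prems[THEN Ck_on_SucD] by (intro Ck_on_add assms(1) Suc.IH) simp_all
  qed
qed

lemma Ck_on_inverse:
  fixes f :: "'a::euclidean_space \<Rightarrow> real"
  assumes "open S" "Ck_on k S f" "\<And>x. x \<in> S \<Longrightarrow> f x \<noteq> 0"
  shows "Ck_on k S (\<lambda>x. inverse (f x))"
  using assms(2)
proof (induction k)
  case 0
  then show ?case using assms(3) by (simp add: continuous_on_inverse)
next
  case (Suc k)
  show ?case
  proof (rule Ck_on_SucI[OF assms(1)])
    \<comment> \<open>The derivative is written as a product containing \<open>inverse (f x)\<close>
      itself, to which the induction hypothesis applies.\<close>
    show "((\<lambda>x. inverse (f x)) has_derivative
        (\<lambda>v. - 1 * (inverse (f x) * frechet_derivative f (at x) v * inverse (f x)))) (at x)"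
      if "x \<in> S" for x
      using Deriv.has_derivative_inverse[OF assms(3)[OF that] Ck_on_Suc_has_derivative[OF Suc.prems that]]
      by simp
    show "Ck_on k S (\<lambda>x. - 1 * (inverse (f x) * frechet_derivative f (at x) v * inverse (f x)))" for v
      using Suc.prems Suc.IH[OF Ck_on_SucD[OF Suc.prems]]
      by (intro Ck_on_mult assms(1) Ck_on_const) simp_all
  qed
qed

lemma Ck_on_subset: "Ck_on k S f \<Longrightarrow> T \<subseteq> S \<Longrightarrow> Ck_on k T f"
proof (induction k arbitrary: f)
  case 0
  then show ?case by (auto intro: continuous_on_subset)
qed auto

lemma open_image_fst:
  fixes U :: "('a::topological_space \<times> 'b::topological_space) set"
  shows "open U \<Longrightarrow> open (fst ` U)"
  using open_map_fst[of "euclidean :: 'a topology" "euclidean :: 'b topology"]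
  by (simp add: open_map_def)

text \<open>Lifts functions of \<open>x\<close> to phase space. The derivative in direction
  \<open>v\<close> is again a function of \<open>fst q\<close>, namely the derivative of
  \<open>f\<close> in direction \<open>fst v\<close>, so the induction closes.\<close>

lemma Ck_on_compose_fst:
  fixes f :: "'a::euclidean_space \<Rightarrow> 'c::real_normed_vector" and U :: "('a \<times> 'b::euclidean_space) set"
  assumes "open U" "Ck_on k (fst ` U) f"
  shows "Ck_on k U (\<lambda>q. f (fst q))"
  using assms(2)
proof (induction k arbitrary: f)
  case 0
  then show ?case
    using continuous_on_compose2[of "fst ` U" f U fst]
      continuous_on_fst[OF continuous_on_id, of U] by (simp add: id_def)
next
  case (Suc k)
  show ?case
  proof (rule Ck_on_SucI[OF assms(1)])
    show "((\<lambda>q. f (fst q)) has_derivative (\<lambda>v. frechet_derivative f (at (fst q)) (fst v))) (at q)"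
      if "q \<in> U" for q
      by (rule has_derivative_compose[OF has_derivative_fst[OF has_derivative_ident]
            Ck_on_Suc_has_derivative[OF Suc.prems]]) (use that in simp)
    show "Ck_on k U (\<lambda>q. frechet_derivative f (at (fst q)) (fst v))" for v
      using Suc.prems by (intro Suc.IH) simp
  qed
qed

lemma Ck_on_sum:
  assumes "open S" "\<And>i. i \<in> A \<Longrightarrow> Ck_on k S (f i)"
  shows "Ck_on k S (\<lambda>x. \<Sum>i\<in>A. f i x)"
  using assms(2) by (induction A rule: infinite_finite_induct) (auto intro: Ck_on_add assms(1) Ck_on_const)

lemma Ck_on_power:
  fixes f :: "'a::euclidean_space \<Rightarrow> real"
  assumes "open S" "Ck_on k S f"
  shows "Ck_on k S (\<lambda>x. f x ^ n)"
  by (induction n) (auto intro: Ck_on_mult assms Ck_on_const)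

lemma smooth_on_Ck_on: "smooth_on S f \<Longrightarrow> Ck_on k S f"
  by (simp add: smooth_on_def)

lemma smooth_on_frechet_derivative:
  "smooth_on S f \<Longrightarrow> smooth_on S (\<lambda>x. frechet_derivative f (at x) v)"
  unfolding smooth_on_def by (metis Ck_on.simps(2))

lemma smooth_on_has_derivative:
  "smooth_on S f \<Longrightarrow> x \<in> S \<Longrightarrow> (f has_derivative frechet_derivative f (at x)) (at x)"
  unfolding smooth_on_def by (rule Ck_on_Suc_has_derivative) blast

section \<open>Invariant densities of contact Hamiltonian vector fields\<close>

text \<open>The bracket of \<open>X\<close> with a constant field \<open>u\<close> is
  \<open>- X' u\<close>, so by \<open>top_form_trace\<close> the sum over the slots produces the
  divergence of \<open>X\<close>.\<close>

lemma lie_deriv_density: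
  fixes \<eta> :: "(nat \<Rightarrow> 'a::euclidean_space) \<Rightarrow> real"
  assumes \<eta>: "alternating_form DIM('a) \<eta>"
    and f: "(f has_derivative f') (at q)" and X: "(X has_derivative X') (at q)"
  shows "lie_deriv DIM('a) X (\<lambda>r v. f r * \<eta> v) q v =
    (f' (X q) + f q * (\<Sum>b\<in>Basis. X' b \<bullet> b)) * \<eta> v"
proof -
  have lin: "linear (\<lambda>u. - X' u)"
    using has_derivative_linear[OF X] by (simp add: linear_iff)
  have "lie_bracket X (\<lambda>_. u) q = - X' u" for u
    using frechet_derivative_at[OF X] by (simp add: lie_bracket_def)
  moreover have "frechet_derivative (\<lambda>r. f r * \<eta> v) (at q) = (\<lambda>u. f' u * \<eta> v)"
    by (rule frechet_derivative_at[symmetric]) (rule has_derivative_mult_left[OF f])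
  ultimately show ?thesis
    using top_form_trace[OF \<eta> lin, of v]
    by (simp add: lie_deriv_def sum_distrib_left[symmetric] sum_negf algebra_simps)
qed

section \<open>Coordinate traces and componentwise derivatives\<close>

lemma sum_Basis_prod:
  "(\<Sum>b\<in>Basis. f b) = (\<Sum>u\<in>Basis. f (u, 0)) + (\<Sum>w\<in>Basis. f (0, w))"
proof -
  have "(\<Sum>b\<in>Basis. f b) = (\<Sum>b\<in>(\<lambda>u. (u, 0)) ` Basis. f b) + (\<Sum>b\<in>Pair 0 ` Basis. f b)"
    unfolding Basis_prod_def by (rule sum.union_disjoint) (auto simp: nonzero_Basis)
  then show ?thesis
    by (simp add: sum.reindex inj_on_def)
qed

lemma sum_Basis_vec: "(\<Sum>b\<in>(Basis :: (real ^ 'n) set). f b) = (\<Sum>a\<in>UNIV. f (axis a 1))"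
proof -
  have *: "(Basis :: (real ^ 'n) set) = range (\<lambda>a. axis a 1)"
    by (auto simp: Basis_vec_def)
  have "inj (\<lambda>a :: 'n. axis a (1::real))"
    by (auto simp: inj_on_def axis_eq_axis)
  then show ?thesis
    unfolding * by (simp add: sum.reindex)
qed

lemma has_derivative_vec_lambda:
  fixes f :: "'n::finite \<Rightarrow> 'a::real_normed_vector \<Rightarrow> real"
  assumes "\<And>a. (f a has_derivative f' a) (at q)"
  shows "((\<lambda>r. \<chi> a. f a r) has_derivative (\<lambda>u. \<chi> a. f' a u)) (at q)"
  unfolding has_derivative_componentwise_within[of "\<lambda>r. \<chi> a. f a r"]
  using assms by (auto simp: Basis_vec_def inner_axis)

text \<open>Insert \<open>X\<close> into its own second defining equation: d\<lambda>(X, X)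
  vanishes, and \<lambda>(X) is \<open>h\<close> by the first.\<close>

lemma contact_hamiltonian_vf_derivative:
  fixes h :: "'n::finite phase \<Rightarrow> real"
  assumes X: "contact_hamiltonian_vf U h X" and q: "q \<in> U"
  shows "frechet_derivative h (at q) (X q) = reeb h q * h q"
proof -
  have "contact_form q (case_nat (X q) (\<lambda>_. X q)) = h q"
    using X q unfolding contact_hamiltonian_vf_def interior_prod_def by blast
  then have "contact_form q (\<lambda>_. X q) = h q"
    by (simp add: contact_form_def case_prod_beta)
  moreover have "interior_prod X (ext_deriv 1 contact_form) q (\<lambda>_. X q) = 0"
    by (simp add: interior_prod_def ext_deriv_contact_form[unfolded One_nat_def] mult.commute)
  moreover have "interior_prod X (ext_deriv 1 contact_form) q (\<lambda>_. X q) =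
      - (ext_deriv 0 (\<lambda>r _. h r) q (\<lambda>_. X q) - reeb h q * contact_form q (\<lambda>_. X q))"
    using X q unfolding contact_hamiltonian_vf_def by blast
  ultimately show ?thesis by (simp add: ext_deriv_def)
qed

text \<open>The volume form is a constant form that is nonzero on some \<open>w\<close>, so it can
  be divided out; the time condition holds because the form is the same at all times.\<close>

lemma contact_invariant_measure_iff:
  fixes X :: "'n::finite phase \<Rightarrow> 'n phase"
  assumes M: "open M" and f: "smooth_on M f"
    and X: "\<And>q. q \<in> M \<Longrightarrow> (X has_derivative X' q) (at q)"
  shows "invariant_measure M X (\<lambda>t q v. f q * contact_volume q v) \<longleftrightarrow>
    (\<forall>q\<in>M. f q \<noteq> 0 \<and>
      frechet_derivative f (at q) (X q) + f q * (\<Sum>b\<in>Basis. X' q b \<bullet> b) = 0)"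
proof -
  define \<eta> where "\<eta> = contact_volume (0 :: 'n phase)"
  have vol: "contact_volume q = \<eta>" for q
    unfolding \<eta>_def by (rule contact_volume_constant)
  have alt: "alternating_form DIM('n phase) \<eta>"
    unfolding \<eta>_def by (rule alternating_form_contact_volume)
  obtain w where w: "\<eta> w \<noteq> 0"
    unfolding \<eta>_def using contact_volume_nonzero by blast
  have lie: "lie_deriv DIM('n phase) X (\<lambda>q v. f q * \<eta> v) q v =
      (frechet_derivative f (at q) (X q) + f q * (\<Sum>b\<in>Basis. X' q b \<bullet> b)) * \<eta> v"
    if "q \<in> M" for q v
    by (rule lie_deriv_density[OF alt smooth_on_has_derivative[OF f that] X[OF that]])
  have "diff_form DIM('n phase) M (\<lambda>q v. f q * \<eta> v)"
    unfolding diff_form_def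
  proof (intro conjI)
    show "\<forall>q\<in>M. \<forall>v w. (\<forall>i<DIM('n phase). v i = w i) \<longrightarrow> f q * \<eta> v = f q * \<eta> w"
      using alternating_form_cong[OF alt] by metis
    show "\<forall>q\<in>M. \<forall>v. \<forall>i<DIM('n phase). linear (\<lambda>u. f q * \<eta> (v(i := u)))"
      using alternating_form_linear[OF alt] by (simp add: linear_iff algebra_simps)
    show "\<forall>q\<in>M. \<forall>v. \<forall>i<DIM('n phase). \<forall>j<DIM('n phase).
        i \<noteq> j \<and> v i = v j \<longrightarrow> f q * \<eta> v = 0"
      using alternating_form_eq_zero[OF alt] by simp
    show "\<forall>v. smooth_on M (\<lambda>q. f q * \<eta> v)"
      using f M by (auto simp: smooth_on_def intro: Ck_on_mult Ck_on_const)
  qed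
  then show ?thesis
    unfolding invariant_measure_def vol using w lie by auto
qed

text \<open>Evaluate the form on one sequence of vectors where the constant volume form is nonzero,
  and divide by that value.\<close>

lemma smooth_on_contact_density:
  fixes f :: "'n::finite phase \<Rightarrow> real"
  assumes "open M" "invariant_measure M X (\<lambda>t q v. f q * contact_volume q v)"
  shows "smooth_on M f"
proof -
  obtain w where w: "contact_volume (0 :: 'n phase) w \<noteq> 0"
    using contact_volume_nonzero by blast
  have "(\<lambda>q. f q * contact_volume q w) = (\<lambda>q. f q * contact_volume (0 :: 'n phase) w)"
    by (rule ext) (rule arg_cong[OF contact_volume_constant[THEN fun_cong]])
  moreover have "smooth_on M (\<lambda>q. f q * contact_volume q w)"
    using assms(2)[unfolded invariant_measure_def, THEN conjunct1, rule_format,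
        unfolded diff_form_def, THEN conjunct2, THEN conjunct2, THEN conjunct2] by (rule spec)
  ultimately have s: "smooth_on M (\<lambda>q. f q * contact_volume (0 :: 'n phase) w)"
    by simp
  have "Ck_on k M (\<lambda>q. f q * contact_volume (0 :: 'n phase) w * inverse (contact_volume (0 :: 'n phase) w))"
    for k
    by (rule Ck_on_mult[OF assms(1) smooth_on_Ck_on[OF s] Ck_on_const])
  then show ?thesis using w by (simp add: smooth_on_def mult.assoc)
qed

text \<open>In coordinates the \<open>x\<close>-part of the field is \<open>F\<close>, and the
  \<open>z\<close>-part is \<open>H x - \<gamma> * z\<close>. The \<open>x\<close>-part contributes
  div F to the divergence, the \<open>p\<close>-part - div F - n \<gamma>, and the
  \<open>z\<close>-part - \<gamma>.\<close>

lemma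
  fixes H :: "real ^ 'n::finite \<Rightarrow> real" and F :: "real ^ 'n \<Rightarrow> real ^ 'n"
  assumes U: "open U" and H: "smooth_on (fst ` U) H" and F: "smooth_on (fst ` U) F"
    and h: "\<And>x p z. (x, p, z) \<in> U \<Longrightarrow> h (x, p, z) = H x - (\<Sum>a\<in>UNIV. p $ a * F x $ a) - \<gamma> * z"
  shows affine_contact_hamiltonian_smooth: "smooth_on U h"
    and affine_contact_hamiltonian_reeb: "\<And>q. q \<in> U \<Longrightarrow> reeb h q = - \<gamma>"
    and affine_contact_hamiltonian_divergence:
      "\<And>X q. contact_hamiltonian_vf U h X \<Longrightarrow> q \<in> U \<Longrightarrow>
        \<exists>X'. (X has_derivative X') (at q) \<and>
          (\<Sum>b\<in>Basis. X' b \<bullet> b) = - (real CARD('n) + 1) * \<gamma>"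
proof -
  have h': "h q = H (fst q) - (\<Sum>a\<in>UNIV. fst (snd q) $ a * F (fst q) $ a) - \<gamma> * snd (snd q)"
    if "q \<in> U" for q
    using h[of "fst q" "fst (snd q)" "snd (snd q)"] that by simp
  have lin: "bounded_linear (\<lambda>q :: 'n phase. fst (snd q) $ a)"
    "bounded_linear (\<lambda>q :: 'n phase. snd (snd q))" for a
    by (simp_all add: linear_conv_bounded_linear[symmetric] linear_iff)
  have "Ck_on k U h" for k
  proof (rule Ck_on_cong[OF U])
    have "Ck_on k U (\<lambda>q. F (fst q) $ a)" for a
      by (rule Ck_on_compose_bounded_linear[OF U bounded_linear_vec_nth
            Ck_on_compose_fst[OF U smooth_on_Ck_on[OF F]]])
    then show "Ck_on k U (\<lambda>q. H (fst q) + - 1 * (\<Sum>a\<in>UNIV. fst (snd q) $ a * F (fst q) $ a)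
        + - \<gamma> * snd (snd q))"
      by (intro Ck_on_add Ck_on_mult Ck_on_const Ck_on_sum U Ck_on_bounded_linear[OF U lin(1)]
          Ck_on_bounded_linear[OF U lin(2)] Ck_on_compose_fst[OF U smooth_on_Ck_on[OF H]])
  qed (simp add: h')
  then show smooth: "smooth_on U h" by (simp add: smooth_on_def)

  define dH where "dH x = frechet_derivative H (at x)" for x
  define dF where "dF x = frechet_derivative F (at x)" for x
  note H' = smooth_on_has_derivative[OF H imageI, folded dH_def]
  note F' = smooth_on_has_derivative[OF F imageI, folded dF_def]
  have zero: "dH (fst q) 0 = 0" "dF (fst q) 0 = 0" if "q \<in> U" for q
    using H'[OF that] F'[OF that] by (auto intro!: linear_0 has_derivative_linear)
  note compose_fst = has_derivative_compose[OF has_derivative_fst[OF has_derivative_ident]]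
  note nth = bounded_linear.has_derivative[OF bounded_linear_vec_nth]
  note lin' = lin[THEN bounded_linear_imp_has_derivative]
  have Dh: "frechet_derivative h (at q) = (\<lambda>u. dH (fst q) (fst u)
      - (\<Sum>a\<in>UNIV. fst (snd q) $ a * dF (fst q) (fst u) $ a + fst (snd u) $ a * F (fst q) $ a)
      - \<gamma> * snd (snd u))" (is "_ = ?D") if q: "q \<in> U" for q
  proof (rule frechet_derivative_at[symmetric], rule has_derivative_transform_within_open[OF _ U q])
    have "((\<lambda>q. \<Sum>a\<in>UNIV. fst (snd q) $ a * F (fst q) $ a) has_derivative (\<lambda>u.
        \<Sum>a\<in>UNIV. fst (snd q) $ a * dF (fst q) (fst u) $ a + fst (snd u) $ a * F (fst q) $ a)) (at q)"
      by (rule has_derivative_sum) (rule has_derivative_mult[OF lin'(1) nth[OF compose_fst[OF F'[OF q]]]])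
    then show "((\<lambda>q. H (fst q) - (\<Sum>a\<in>UNIV. fst (snd q) $ a * F (fst q) $ a) - \<gamma> * snd (snd q))
        has_derivative ?D) (at q)"
      by (intro has_derivative_diff compose_fst[OF H'[OF q]] has_derivative_mult_right lin'(2))
  qed (simp add: h')
  show "reeb h q = - \<gamma>" if "q \<in> U" for q
    using that by (simp add: reeb_def Dh zero)

  fix X q assume X: "contact_hamiltonian_vf U h X" and q: "q \<in> U"
  have ax: "(\<Sum>b\<in>UNIV. axis a 1 $ b * y $ b) = y $ a" for a and y :: "real ^ 'n"
    using inner_axis'[of a 1 y] by (simp add: inner_vec_def)
  \<comment> \<open>The coordinate formula for \<open>X\<close> with \<open>h\<close> substituted;
    in the last component the terms \<open>p $ a * F x $ a\<close> cancel. It is matched with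
    \<open>X\<close> only on \<open>U\<close>, which is enough for derivatives as \<open>U\<close>
    is open.\<close>
  define Y where "Y r = (F (fst r),
      \<chi> a. dH (fst r) (axis a 1) - (\<Sum>b\<in>UNIV. fst (snd r) $ b * dF (fst r) (axis a 1) $ b)
        - \<gamma> * fst (snd r) $ a,
      H (fst r) - \<gamma> * snd (snd r))" for r :: "'n phase"
  have XY: "Y r = X r" if r: "r \<in> U" for r
  proof -
    obtain x p z where xpz: "r = (x, p, z)" by (cases r) auto
    have "\<And>r. r \<in> U \<Longrightarrow> h differentiable at r"
      using smooth_on_has_derivative[OF smooth] by (auto intro: differentiableI)
    from bspec[OF iffD1[OF contact_hamiltonian_vf_coordinates[OF this] X] r]
    have "X (x, p, z) = (\<chi> a. F x $ a,
        \<chi> a. dH x (axis a 1) - (\<Sum>b\<in>UNIV. p $ b * dF x (axis a 1) $ b) + p $ a * - \<gamma>,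
        h (x, p, z) - (\<Sum>a\<in>UNIV. p $ a * - F x $ a))"
      using zero[OF r] unfolding xpz by (simp add: Let_def Dh[OF r[unfolded xpz]] ax sum_negf)
    then show ?thesis
      using h[OF r[unfolded xpz]] by (simp add: xpz Y_def sum_negf mult.commute vec_eq_iff)
  qed
  \<comment> \<open>\<open>A\<close> and \<open>B\<close> are the second derivatives of
    \<open>H\<close> and \<open>F\<close>. They depend only on the \<open>x\<close>-part of a
    direction, so they drop out of the diagonal entries for \<open>p\<close>.\<close>
  define A where "A a = frechet_derivative (\<lambda>x. dH x (axis a 1)) (at (fst q))" for a
  define B where "B a = frechet_derivative (\<lambda>x. dF x (axis a 1)) (at (fst q))" for a
  have A': "((\<lambda>x. dH x (axis a 1)) has_derivative A a) (at (fst q))" for a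
    unfolding A_def dH_def
    by (rule smooth_on_has_derivative[OF smooth_on_frechet_derivative[OF H] imageI[OF q]])
  have B': "((\<lambda>x. dF x (axis a 1)) has_derivative B a) (at (fst q))" for a
    unfolding B_def dF_def
    by (rule smooth_on_has_derivative[OF smooth_on_frechet_derivative[OF F] imageI[OF q]])
  have AB0: "A a 0 = 0" "B a 0 = 0" for a
    using A'[of a] B'[of a] by (auto intro!: linear_0 has_derivative_linear)
  define X' where "X' u = (dF (fst q) (fst u),
      \<chi> a. A a (fst u)
        - (\<Sum>b\<in>UNIV. fst (snd q) $ b * B a (fst u) $ b + fst (snd u) $ b * dF (fst q) (axis a 1) $ b)
        - \<gamma> * fst (snd u) $ a,
      dH (fst q) (fst u) - \<gamma> * snd (snd u))" for u :: "'n phase"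
  have sum: "((\<lambda>r. \<Sum>b\<in>UNIV. fst (snd r) $ b * dF (fst r) (axis a 1) $ b) has_derivative
      (\<lambda>u. \<Sum>b\<in>UNIV. fst (snd q) $ b * B a (fst u) $ b + fst (snd u) $ b * dF (fst q) (axis a 1) $ b))
      (at q)" for a
    by (rule has_derivative_sum) (rule has_derivative_mult[OF lin'(1) nth[OF compose_fst[OF B']]])
  have "(Y has_derivative X') (at q)"
    unfolding Y_def X'_def
    by (intro has_derivative_Pair has_derivative_vec_lambda has_derivative_diff has_derivative_mult_right
        lin' compose_fst[OF H'[OF q]] compose_fst[OF F'[OF q]] compose_fst[OF A'] sum)
  then have "(X has_derivative X') (at q)"
    by (rule has_derivative_transform_within_open[OF _ U q XY])
  moreover have "(\<Sum>b\<in>Basis. X' b \<bullet> b) = - (real CARD('n) + 1) * \<gamma>"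
    by (simp add: sum_Basis_prod sum_Basis_vec X'_def inner_axis AB0 zero[OF q] ax sum_negf
        sum_subtractf algebra_simps)
  ultimately show "\<exists>X'. (X has_derivative X') (at q) \<and>
      (\<Sum>b\<in>Basis. X' b \<bullet> b) = - (real CARD('n) + 1) * \<gamma>" by blast
qed

theorem theorem4p1:
  fixes U :: "('n::finite) phase set"
    and \<psi> :: "real ^ 'n \<Rightarrow> real"
    and F :: "real ^ 'n \<Rightarrow> real ^ 'n"
    and \<gamma>\<^sub>0 :: real
    and h :: "'n phase \<Rightarrow> real"
    and X :: "'n phase \<Rightarrow> 'n phase"
    and M :: "'n phase set"
  assumes "open U"
    and "smooth_on (fst ` U) \<psi>"
    and "smooth_on (fst ` U) F"
    and "\<And>a. \<exists>x\<in>fst ` U. F x $ a \<noteq> 0"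
    and "\<gamma>\<^sub>0 \<noteq> 0"
    and "\<And>x p z. (x, p, z) \<in> U \<Longrightarrow>
           h (x, p, z) = (\<Sum>a\<in>UNIV. (partial_deriv \<psi> a x - p $ a) * F x $ a) + \<gamma>\<^sub>0 * (\<psi> x - z)"
    and "contact_hamiltonian_vf U h X"
    and "M = {q \<in> U. h q > 0}"
  shows "(\<forall>Z. Z \<noteq> 0 \<longrightarrow>
            invariant_measure M X
              (\<lambda>t q v. (1 / Z * h q powi (- (int CARD('n) + 1))) * contact_volume q v)) \<and>
         (connected U \<longrightarrow>
            (\<forall>f. (\<exists>g. \<forall>q\<in>M. f q = g (h q)) \<longrightarrow>
                 invariant_measure M X (\<lambda>t q v. f q * contact_volume q v) \<longrightarrow>
                 (\<exists>Z. Z \<noteq> 0 \<and> (\<forall>q\<in>M. f q = 1 / Z * h q powi (- (int CARD('n) + 1))))))"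
proof -
  \<comment> \<open>Collects the terms of \<open>h\<close> that depend on \<open>x\<close> alone, so
    that the results on Hamiltonians affine in \<open>p\<close> and \<open>z\<close> apply.\<close>
  define H where "H x = (\<Sum>a\<in>UNIV. partial_deriv \<psi> a x * F x $ a) + \<gamma>\<^sub>0 * \<psi> x" for x
  have S: "open (fst ` U)" by (rule open_image_fst[OF assms(1)])
  have "Ck_on k (fst ` U) H" for k
  proof -
    have "Ck_on k (fst ` U) (\<lambda>x. F x $ a)" for a
      by (rule Ck_on_compose_bounded_linear[OF S bounded_linear_vec_nth smooth_on_Ck_on[OF assms(3)]])
    moreover have "Ck_on k (fst ` U) (partial_deriv \<psi> a)" for a
      using smooth_on_Ck_on[OF smooth_on_frechet_derivative[OF assms(2)]]
      by (simp add: partial_deriv_def[abs_def])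
    ultimately show ?thesis
      unfolding H_def
      by (intro Ck_on_add Ck_on_mult Ck_on_const Ck_on_sum S smooth_on_Ck_on[OF assms(2)])
  qed
  then have H: "smooth_on (fst ` U) H" by (simp add: smooth_on_def)
  have h: "h (x, p, z) = H x - (\<Sum>a\<in>UNIV. p $ a * F x $ a) - \<gamma>\<^sub>0 * z" if "(x, p, z) \<in> U" for x p z
    by (simp add: assms(6)[OF that] H_def sum_subtractf left_diff_distrib right_diff_distrib)
  have smooth_h: "smooth_on U h"
    by (rule affine_contact_hamiltonian_smooth[OF assms(1) H assms(3) h])
  note h' = smooth_on_has_derivative[OF smooth_h]
  have Dh_X: "frechet_derivative h (at q) (X q) = - \<gamma>\<^sub>0 * h q" if "q \<in> U" for q
    using contact_hamiltonian_vf_derivative[OF assms(7) that]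
      affine_contact_hamiltonian_reeb[OF assms(1) H assms(3) h that] by simp
  have "\<forall>q\<in>U. \<exists>X'. (X has_derivative X') (at q) \<and>
      (\<Sum>b\<in>Basis. X' b \<bullet> b) = - (real CARD('n) + 1) * \<gamma>\<^sub>0"
    by (rule ballI) (rule affine_contact_hamiltonian_divergence[OF assms(1) H assms(3) h assms(7)])
  from bchoice[OF this] obtain X' where X': "\<And>q. q \<in> U \<Longrightarrow> (X has_derivative X' q) (at q)"
    "\<And>q. q \<in> U \<Longrightarrow> (\<Sum>b\<in>Basis. X' q b \<bullet> b) = - (real CARD('n) + 1) * \<gamma>\<^sub>0"
    by blast
  have cont: "continuous_on U h"
    using smooth_on_Ck_on[OF smooth_h, of 0] by simp
  have M: "M = U \<inter> h -` {0<..}" using assms(8) by auto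
  have M_open: "open M"
    unfolding M using cont assms(1) by (rule continuous_open_preimage) simp
  \<comment> \<open>Both halves rest on this criterion: derivative and divergence share the factor
    \<open>- \<gamma>\<^sub>0\<close>, and dividing by it leaves Euler's equation for
    \<open>g\<close>.\<close>
  have density: "invariant_measure M X (\<lambda>t q v. f q * contact_volume q v) \<longleftrightarrow>
      (\<forall>q\<in>M. f q \<noteq> 0 \<and> h q * g' (h q) = - (real CARD('n) + 1) * f q)"
    if f: "smooth_on M f" and fg: "\<And>q. q \<in> M \<Longrightarrow> f q = g (h q)"
      and g: "\<And>s. s \<in> h ` M \<Longrightarrow> (g has_real_derivative g' s) (at s)" for f g g'
  proof -
    have eq: "frechet_derivative f (at q) (X q) + f q * (\<Sum>b\<in>Basis. X' q b \<bullet> b) = 0 \<longleftrightarrow>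
        h q * g' (h q) = - (real CARD('n) + 1) * f q" if q: "q \<in> M" for q
    proof -
      have U: "q \<in> U" using q M by simp
      have "((\<lambda>q. g (h q)) has_derivative (\<lambda>u. frechet_derivative h (at q) u * g' (h q))) (at q)"
        by (rule DERIV_compose_FDERIV[OF g h'[OF U]]) (use q in simp)
      then have "(f has_derivative (\<lambda>u. frechet_derivative h (at q) u * g' (h q))) (at q)"
        by (rule has_derivative_transform_within_open[OF _ M_open q]) (simp add: fg)
      from fun_cong[OF frechet_derivative_at[OF this], of "X q"]
      have "frechet_derivative f (at q) (X q) = - \<gamma>\<^sub>0 * h q * g' (h q)"
        using Dh_X[OF U] by simp
      then have "frechet_derivative f (at q) (X q) + f q * (\<Sum>b\<in>Basis. X' q b \<bullet> b) =
          - \<gamma>\<^sub>0 * (h q * g' (h q) - - (real CARD('n) + 1) * f q)"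
        unfolding X'(2)[OF U] by (simp add: algebra_simps)
      then show ?thesis
        using assms(5) by (simp only: mult_eq_0_iff neg_equal_0_iff_equal right_minus_eq) simp
    qed
    have "invariant_measure M X (\<lambda>t q v. f q * contact_volume q v) \<longleftrightarrow> (\<forall>q\<in>M. f q \<noteq> 0 \<and>
        frechet_derivative f (at q) (X q) + f q * (\<Sum>b\<in>Basis. X' q b \<bullet> b) = 0)"
      by (rule contact_invariant_measure_iff[OF M_open f X'(1)]) (simp add: M)
    also have "\<dots> \<longleftrightarrow> (\<forall>q\<in>M. f q \<noteq> 0 \<and> h q * g' (h q) = - (real CARD('n) + 1) * f q)"
      by (rule ball_cong[OF refl]) (simp only: eq)
    finally show ?thesis .
  qed
  show ?thesis
  proof (intro conjI allI impI)

    \<comment> \<open>Invariance of the power density\<close>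
    fix Z :: real assume Z: "Z \<noteq> 0"
    define k where "k = - (int CARD('n) + 1)"
    \<comment> \<open>As a natural power of the inverse, the density is covered by the closure
      properties of \<open>Ck_on\<close>.\<close>
    have k: "x powi k = inverse x ^ (CARD('n) + 1)" for x :: real
      by (simp add: k_def power_int_def nat_add_distrib)
    have "Ck_on j M (\<lambda>q. 1 / Z * inverse (h q) ^ (CARD('n) + 1))" for j
      using M_open Ck_on_subset[OF smooth_on_Ck_on[OF smooth_h], of M j]
      by (intro Ck_on_mult Ck_on_const Ck_on_power Ck_on_inverse) (auto simp: M)
    then have smooth: "smooth_on M (\<lambda>q. 1 / Z * h q powi k)"
      by (simp add: smooth_on_def k)
    have deriv: "((\<lambda>s. 1 / Z * s powi k) has_real_derivative 1 / Z * (of_int k * s powi (k - 1))) (at s)"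
      if "s \<in> h ` M" for s
    proof -
      have "s \<noteq> 0" using that M by auto
      from DERIV_cmult[OF DERIV_power_int[OF DERIV_ident disjI2[OF this], of k], of "1 / Z"]
      show ?thesis by simp
    qed
    show "invariant_measure M X
        (\<lambda>t q v. (1 / Z * h q powi (- (int CARD('n) + 1))) * contact_volume q v)"
      unfolding k_def[symmetric]
    proof (rule iffD2[OF density[OF smooth refl deriv]], assumption, intro ballI conjI)
      fix q assume "q \<in> M"
      then have pos: "h q > 0" by (simp add: M)
      then show "1 / Z * h q powi k \<noteq> 0" using Z by simp
      have "h q powi (k - 1) * h q = h q powi k"
        by (rule power_int_minus_mult) (use pos in simp)
      then show "h q * (1 / Z * (of_int k * h q powi (k - 1))) =
          - (real CARD('n) + 1) * (1 / Z * h q powi k)"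
        by (simp add: k_def field_simps)
    qed
  next

    \<comment> \<open>Uniqueness among densities that are functions of \<open>h\<close>\<close>
    fix f assume conn: "connected U" and "\<exists>g. \<forall>q\<in>M. f q = g (h q)"
      and inv: "invariant_measure M X (\<lambda>t q v. f q * contact_volume q v)"
    then obtain g where g: "\<And>q. q \<in> M \<Longrightarrow> f q = g (h q)" by blast
    have f: "smooth_on M f"
      by (rule smooth_on_contact_density[OF M_open inv])
    have "\<exists>D. (g has_real_derivative D) (at s)" if s: "s \<in> h ` M" for s
    proof -
      obtain q where q: "q \<in> M" "h q = s" using s by blast
      \<comment> \<open>Along the \<open>z\<close>-direction \<open>h\<close> is affine with nonzero slope, so \<open>g\<close> is \<open>f\<close> restricted to a line.\<close>
      define l :: "real \<Rightarrow> 'n phase" where "l t = q + (t - s) *\<^sub>R (0, 0, - 1 / \<gamma>\<^sub>0)" for t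
      have l': "(l has_derivative (\<lambda>t. t *\<^sub>R (0, 0, - 1 / \<gamma>\<^sub>0))) (at t)" for t
      proof -
        have "((\<lambda>t. q + (t - s) *\<^sub>R e) has_derivative (\<lambda>t. t *\<^sub>R e)) (at t)" for e
          by (auto intro!: derivative_eq_intros)
        then show ?thesis unfolding l_def .
      qed
      have ls: "l s = q" by (simp add: l_def zero_prod_def)
      have hl: "h (l t) = t" if "l t \<in> U" for t
      proof -
        obtain x p z where xpz: "q = (x, p, z)" by (cases q) auto
        have "(x, p, z) \<in> U" using q(1) M xpz by simp
        then have "s = H x - (\<Sum>a\<in>UNIV. p $ a * F x $ a) - \<gamma>\<^sub>0 * z"
          using q(2) h xpz by simp
        moreover have lt: "l t = (x, p, z - (t - s) / \<gamma>\<^sub>0)"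
          by (simp add: l_def xpz)
        moreover have "\<gamma>\<^sub>0 * (z - (t - s) / \<gamma>\<^sub>0) = \<gamma>\<^sub>0 * z - (t - s)"
          using assms(5) by (simp add: field_simps)
        ultimately show ?thesis
          using h[OF that[unfolded lt]] unfolding lt by linarith
      qed
      have "f differentiable at q"
        using smooth_on_has_derivative[OF f q(1)] by (rule differentiableI)
      then have "(f \<circ> l) differentiable at s"
        using l' by (intro differentiable_chain_at) (auto simp: ls intro: differentiableI)
      then obtain D where D: "((f \<circ> l) has_real_derivative D) (at s)"
        unfolding real_differentiable_def by blast
      have "continuous_on UNIV l"
        using l' by (auto intro!: continuous_at_imp_continuous_on has_derivative_continuous)
      then have "open (l -` M)"
        using M_open by (simp add: open_vimage)
      moreover have "s \<in> l -` M" using q ls by simp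
      moreover have "(f \<circ> l) t = g t" if "t \<in> l -` M" for t
        using g[of "l t"] hl[of t] that M by simp
      ultimately have "(g has_real_derivative D) (at s)"
        using D has_field_derivative_transform_within_open by blast
      then show ?thesis by blast
    qed
    then obtain g' where g': "\<And>s. s \<in> h ` M \<Longrightarrow> (g has_real_derivative g' s) (at s)"
      by metis
    have ode: "s * g' s = - (real CARD('n) + 1) * g s" "g s \<noteq> 0" "s > 0" if "s \<in> h ` M" for s
      using density[OF f g g'] inv that g M by auto
    have "h ` M = h ` U \<inter> {0<..}" using M by auto
    moreover have "convex (h ` U)"
      using connected_continuous_image[OF cont conn] connected_convex_1 by blast
    ultimately have conv: "convex (h ` M)"
      by (simp add: convex_Int)
    have "((\<lambda>s. g s * s ^ (CARD('n) + 1)) has_real_derivative 0) (at s within h ` M)"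
      if s: "s \<in> h ` M" for s
    proof -
      have "((\<lambda>s. g s * s ^ (CARD('n) + 1)) has_real_derivative
          g' s * s ^ (CARD('n) + 1) + (real CARD('n) + 1) * s ^ CARD('n) * g s) (at s within h ` M)"
        using DERIV_mult[OF has_field_derivative_at_within[OF g'[OF s]] DERIV_pow[of "CARD('n) + 1"]]
        by (simp add: add.commute)
      moreover have "g' s * s ^ (CARD('n) + 1) + (real CARD('n) + 1) * s ^ CARD('n) * g s =
          s ^ CARD('n) * (s * g' s + (real CARD('n) + 1) * g s)"
        by (simp add: algebra_simps)
      moreover have "s * g' s + (real CARD('n) + 1) * g s = 0"
        unfolding ode(1)[OF s] by (simp add: algebra_simps)
      ultimately show ?thesis by (simp only: mult_zero_right)
    qed
    from has_field_derivative_zero_constant[OF conv this]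
    obtain c where c: "\<And>s. s \<in> h ` M \<Longrightarrow> g s * s ^ (CARD('n) + 1) = c" by blast
    show "\<exists>Z. Z \<noteq> 0 \<and> (\<forall>q\<in>M. f q = 1 / Z * h q powi (- (int CARD('n) + 1)))"
    proof (cases "M = {}")
      case True
      \<comment> \<open>The formula is vacuous over an empty region; the witness 1 merely has to be
        nonzero.\<close>
      then show ?thesis by (intro exI[of _ 1]) simp
    next
      case False
      then obtain s where "s \<in> h ` M" by blast
      \<comment> \<open>An invariant measure does not vanish and \<open>s\<close> is positive, so
        \<open>Z = 1 / c\<close> is a legitimate constant.\<close>
      then have "c \<noteq> 0" using c[of s] ode(2,3)[of s] by auto
      moreover have "f q = 1 / (1 / c) * h q powi (- (int CARD('n) + 1))" if "q \<in> M" for q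
        using c[of "h q"] ode(3)[of "h q"] g[OF that] that
        by (auto simp: power_int_def nat_add_distrib field_simps)
      ultimately show ?thesis by (intro exI[of _ "1 / c"]) simp
    qed
  qed
qed

end
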